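(* Let $-\Delta$ be the Euclidean Laplacian on $\mathbb{R}^3$ and let $\alpha, \beta \in \mathbb{R}$ satisfy $\alpha \leq 1/2$ or $\beta \leq 1/2$ or $\alpha + \beta < 2$. Then there is no constant $C$ such that, for all $z \in \mathbb{C}\setminus\mathbb{R}$ with $|z|<1$, the operator $\langle x\rangle^{-\alpha}(-\Delta - z)^{-1}\langle x\rangle^{-\beta}$ is bounded on $L^2(\mathbb{R}^3)$ with $$\big\| \langle x\rangle^{-\alpha} (-\Delta - z)^{-1} \langle x\rangle^{-\beta} \big\| \leq C .$$
   Context: $\langle x\rangle = (1+|x|^2)^{1/2}$, and $\langle x\rangle^{s}$ also denotes the operator of multiplication by this function. $-\Delta$ is the self-adjoint operator on $L^2(\mathbb{R}^3)$ with domain $H^2(\mathbb{R}^3)$, and $\|\cdot\|$ is the operator norm on $L^2(\mathbb{R}^3)$. "Bounded" means that the operator, defined on $C_0^\infty(\mathbb{R}^3)$, extends to a bounded operator on $L^2(\mathbb{R}^3)$. *)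

theory Defs
  imports "HOL-Analysis.Analysis"
begin

type_synonym R3_fun = "real ^ 3 \<Rightarrow> complex"

section \<open>Test functions\<close>

definition partial :: "3 \<Rightarrow> R3_fun \<Rightarrow> R3_fun" where
  "partial i f = (\<lambda>x. frechet_derivative f (at x) (axis i 1))"

primrec Ck :: "nat \<Rightarrow> R3_fun \<Rightarrow> bool" where
  "Ck 0 f \<longleftrightarrow> continuous_on UNIV f"
| "Ck (Suc k) f \<longleftrightarrow> (\<forall>x. f differentiable (at x)) \<and> (\<forall>i. Ck k (partial i f))"

definition test_functions :: "R3_fun set" where
  "test_functions = {\<phi>. (\<forall>k. Ck k \<phi>) \<and> compact (closure {x. \<phi> x \<noteq> 0})}"

section \<open>The space of square-integrable functions\<close>

(* Elements of L2 are Borel representatives of the usual classes; equality in L2 is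
   everywhere below rendered as equality almost everywhere. *)
definition L2 :: "R3_fun set" where
  "L2 = {f \<in> borel_measurable lborel. integrable lborel (\<lambda>x. (cmod (f x))\<^sup>2)}"

definition L2_norm :: "R3_fun \<Rightarrow> real" where
  "L2_norm f = sqrt (LINT x|lborel. (cmod (f x))\<^sup>2)"

definition L2_eq :: "R3_fun \<Rightarrow> R3_fun \<Rightarrow> bool" where
  "L2_eq f g \<longleftrightarrow> (AE x in lborel. f x = g x)"

section \<open>Operators in L2, given by their graphs\<close>

(* Possibly unbounded and partially defined; all graphs below are closed under a.e. equality
   in both components. *)
type_synonym L2_operator = "(R3_fun \<times> R3_fun) set"

definition weak_partial :: "3 \<Rightarrow> R3_fun \<Rightarrow> R3_fun \<Rightarrow> bool" where
  "weak_partial i u v \<longleftrightarrow>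
     (\<forall>\<phi>\<in>test_functions. (LINT x|lborel. u x * partial i \<phi> x) = - (LINT x|lborel. v x * \<phi> x))"

definition H2 :: "R3_fun set" where
  "H2 = {u \<in> L2. \<forall>i. \<exists>v\<in>L2. weak_partial i u v \<and> (\<forall>j. \<exists>w\<in>L2. weak_partial j v w)}"

definition weak_laplacian :: "R3_fun \<Rightarrow> R3_fun \<Rightarrow> bool" where
  "weak_laplacian u h \<longleftrightarrow>
     (\<forall>\<phi>\<in>test_functions.
        (LINT x|lborel. u x * (\<Sum>i\<in>UNIV. partial i (partial i \<phi>) x)) = (LINT x|lborel. h x * \<phi> x))"

definition neg_laplacian :: L2_operator where
  "neg_laplacian = {(u, h). u \<in> H2 \<and> h \<in> L2 \<and> weak_laplacian u (\<lambda>x. - h x)}"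

definition shift_operator :: "L2_operator \<Rightarrow> complex \<Rightarrow> L2_operator" where
  "shift_operator A z = {(u, g). g \<in> L2 \<and> (\<exists>h. (u, h) \<in> A \<and> L2_eq g (\<lambda>x. h x - z * u x))}"

definition resolvent :: "L2_operator \<Rightarrow> complex \<Rightarrow> L2_operator" where
  "resolvent A z = (shift_operator A z)\<inverse>"

definition mult_operator :: "(real ^ 3 \<Rightarrow> real) \<Rightarrow> L2_operator" where
  "mult_operator m = {(f, g). f \<in> L2 \<and> g \<in> L2 \<and> L2_eq g (\<lambda>x. of_real (m x) * f x)}"

definition japanese_bracket :: "real ^ 3 \<Rightarrow> real" where
  "japanese_bracket x = sqrt (1 + (norm x)\<^sup>2)"

(* In r O s the relation r acts first. *)
definition weighted_resolvent :: "real \<Rightarrow> real \<Rightarrow> complex \<Rightarrow> L2_operator" where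
  "weighted_resolvent \<alpha> \<beta> z =
     mult_operator (\<lambda>x. japanese_bracket x powr (-\<beta>)) O
     resolvent neg_laplacian z O
     mult_operator (\<lambda>x. japanese_bracket x powr (-\<alpha>))"

section \<open>Bounded operators on L2\<close>

definition bounded_L2_operator :: "(R3_fun \<Rightarrow> R3_fun) \<Rightarrow> bool" where
  "bounded_L2_operator T \<longleftrightarrow>
     (\<forall>f\<in>L2. T f \<in> L2) \<and>
     (\<forall>f\<in>L2. \<forall>g\<in>L2. L2_eq f g \<longrightarrow> L2_eq (T f) (T g)) \<and>
     (\<forall>f\<in>L2. \<forall>g\<in>L2. L2_eq (T (\<lambda>x. f x + g x)) (\<lambda>x. T f x + T g x)) \<and>
     (\<forall>c. \<forall>f\<in>L2. L2_eq (T (\<lambda>x. c * f x)) (\<lambda>x. c * T f x)) \<and>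
     (\<exists>B. \<forall>f\<in>L2. L2_norm (T f) \<le> B * L2_norm f)"

definition L2_operator_norm :: "(R3_fun \<Rightarrow> R3_fun) \<Rightarrow> real" where
  "L2_operator_norm T = Sup {L2_norm (T f) | f. f \<in> L2 \<and> L2_norm f \<le> 1}"

definition extends_from_test_functions :: "(R3_fun \<Rightarrow> R3_fun) \<Rightarrow> L2_operator \<Rightarrow> bool" where
  "extends_from_test_functions T A \<longleftrightarrow>
     test_functions \<subseteq> Domain A \<and>
     (\<forall>f\<in>test_functions. \<forall>g. (f, g) \<in> A \<longrightarrow> L2_eq (T f) g)"

definition bounded_with_norm_le :: "L2_operator \<Rightarrow> real \<Rightarrow> bool" where
  "bounded_with_norm_le A C \<longleftrightarrow>
     (\<exists>T. bounded_L2_operator T \<and> extends_from_test_functions T A \<and> L2_operator_norm T \<le> C)"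

end

theory Submission
  imports Defs
begin

text \<open>Write \<open>J = japanese_bracket\<close> and \<open>P = - \<Delta> - z\<close>. A bound on the weighted resolvent that is uniform in \<open>z\<close>
  gives, for all test functions \<open>g\<close> and \<open>v\<close>,
  \<open>|\<integral> J\<^sup>-\<^sup>a g v| \<le> C \<parallel>g\<parallel> \<parallel>J\<^sup>b P v\<parallel>\<close> with \<open>(a, b) = (\<alpha>, \<beta>)\<close>, because \<open>(J\<^sup>\<beta> P v, J\<^sup>-\<^sup>\<alpha> v)\<close> lies in
  the graph of the operator, and also with \<open>(a, b) = (\<beta>, \<alpha>)\<close>, because \<open>g\<close> lies in its domain and the
  resolvent is symmetric for the bilinear pairing. For real \<open>v\<close> one may let \<open>z\<close> tend to a real energy
  \<open>\<kappa> \<in> [0, 1)\<close>. At \<open>\<kappa> = 0\<close>, taking for \<open>g\<close> and \<open>v\<close> a smooth cutoff at radius \<open>R \<rightarrow> \<infinity>\<close> forces \<open>a + b \<ge> 2\<close>.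
  At \<open>\<kappa> > 0\<close>, the spherical wave \<open>sin (r sqrt \<kappa>) / (r sqrt \<kappa>)\<close> with a logarithmic cutoff makes the right-hand side
  tend to \<open>0\<close> for a fixed \<open>g\<close> if \<open>b \<le> 1 / 2\<close>. All functions are radial, written as functions of
  \<open>s = |x|\<^sup>2\<close>.\<close>

section \<open>Smooth functions on the line\<close>

text \<open>Order zero asks for nothing, not even continuity; continuity first comes with
  \<open>ndiff (Suc 0)\<close>. This is the source of the index shift in
  \<open>Ck_radial\<close>.\<close>

primrec ndiff :: "nat \<Rightarrow> (real \<Rightarrow> real) \<Rightarrow> bool" where
  "ndiff 0 f \<longleftrightarrow> True"
| "ndiff (Suc n) f \<longleftrightarrow> (\<forall>s. f field_differentiable (at s)) \<and> ndiff n (deriv f)"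

definition smooth :: "(real \<Rightarrow> real) \<Rightarrow> bool" where
  "smooth f \<longleftrightarrow> (\<forall>n. ndiff n f)"

lemma ndiff_SucI:
  assumes "\<And>s. (f has_real_derivative f' s) (at s)" "ndiff n f'"
  shows "ndiff (Suc n) f"
proof -
  have "deriv f = f'" using assms(1) DERIV_imp_deriv by blast
  then show ?thesis using assms by (auto simp: field_differentiable_def)
qed

lemma ndiff_SucD:
  assumes "ndiff (Suc n) f"
  shows "(f has_real_derivative deriv f s) (at s)" "ndiff n (deriv f)"
  using assms by (auto simp: DERIV_deriv_iff_field_differentiable)

lemma ndiff_Suc_imp: "ndiff (Suc n) f \<Longrightarrow> ndiff n f"
  by (induction n arbitrary: f) auto

lemma ndiff_const: "ndiff n (\<lambda>s. c)"
proof (induction n arbitrary: c)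
  case (Suc n)
  show ?case by (rule ndiff_SucI[where f' = "\<lambda>s. 0"]) (auto intro: Suc)
qed simp

lemma ndiff_id: "ndiff n (\<lambda>s. s)"
proof (cases n)
  case (Suc m)
  show ?thesis unfolding Suc by (rule ndiff_SucI[where f' = "\<lambda>s. 1"]) (auto intro: ndiff_const)
qed simp

lemma ndiff_add: "ndiff n f \<Longrightarrow> ndiff n g \<Longrightarrow> ndiff n (\<lambda>s. f s + g s)"
proof (induction n arbitrary: f g)
  case (Suc n)
  show ?case
    by (rule ndiff_SucI[OF DERIV_add[OF ndiff_SucD(1)[OF Suc.prems(1)] ndiff_SucD(1)[OF Suc.prems(2)]]])
      (intro Suc.IH ndiff_SucD(2) Suc.prems)
qed simp

lemma ndiff_mult: "ndiff n f \<Longrightarrow> ndiff n g \<Longrightarrow> ndiff n (\<lambda>s. f s * g s)"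
proof (induction n arbitrary: f g)
  case (Suc n)
  show ?case
  proof (rule ndiff_SucI[where f' = "\<lambda>s. deriv f s * g s + deriv g s * f s"])
    show "((\<lambda>s. f s * g s) has_real_derivative deriv f s * g s + deriv g s * f s) (at s)" for s
      by (intro DERIV_mult ndiff_SucD(1)[OF Suc.prems(1)] ndiff_SucD(1)[OF Suc.prems(2)])
    show "ndiff n (\<lambda>s. deriv f s * g s + deriv g s * f s)"
      by (intro ndiff_add Suc.IH ndiff_Suc_imp[OF Suc.prems(1)] ndiff_Suc_imp[OF Suc.prems(2)]
          ndiff_SucD(2)[OF Suc.prems(1)] ndiff_SucD(2)[OF Suc.prems(2)])
  qed
qed simp

lemma ndiff_compose: "ndiff n f \<Longrightarrow> ndiff n g \<Longrightarrow> ndiff n (\<lambda>s. f (g s))"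
proof (induction n arbitrary: f g)
  case (Suc n)
  show ?case
  proof (rule ndiff_SucI[where f' = "\<lambda>s. deriv f (g s) * deriv g s"])
    show "((\<lambda>s. f (g s)) has_real_derivative deriv f (g s) * deriv g s) (at s)" for s
      by (rule DERIV_chain2[OF ndiff_SucD(1)[OF Suc.prems(1)] ndiff_SucD(1)[OF Suc.prems(2)]])
    show "ndiff n (\<lambda>s. deriv f (g s) * deriv g s)"
      by (rule ndiff_mult[OF Suc.IH[OF ndiff_SucD(2)[OF Suc.prems(1)] ndiff_Suc_imp[OF Suc.prems(2)]]
          ndiff_SucD(2)[OF Suc.prems(2)]])
  qed
qed simp

lemma smooth_deriv:
  assumes "smooth f"
  shows "(f has_real_derivative deriv f s) (at s)" "smooth (deriv f)"
  using assms ndiff_SucD unfolding smooth_def by blast+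

lemma smooth_continuous: "smooth f \<Longrightarrow> continuous_on S f"
  by (meson DERIV_continuous_on has_field_derivative_at_within smooth_deriv(1))

lemma smooth_const: "smooth (\<lambda>s. c)"
  and smooth_id: "smooth (\<lambda>s. s)"
  and smooth_add: "smooth f \<Longrightarrow> smooth g \<Longrightarrow> smooth (\<lambda>s. f s + g s)"
  and smooth_mult: "smooth f \<Longrightarrow> smooth g \<Longrightarrow> smooth (\<lambda>s. f s * g s)"
  and smooth_compose: "smooth f \<Longrightarrow> smooth g \<Longrightarrow> smooth (\<lambda>s. f (g s))"
  unfolding smooth_def by (simp_all add: ndiff_const ndiff_id ndiff_add ndiff_mult ndiff_compose)

lemma smooth_sum: "(\<And>j. j \<in> A \<Longrightarrow> smooth (f j)) \<Longrightarrow> smooth (\<lambda>s. \<Sum>j\<in>A. f j s)"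
  by (induction A rule: infinite_finite_induct) (auto intro: smooth_const smooth_add)

section \<open>A smooth cutoff on the line\<close>

definition flat_exp :: "nat \<Rightarrow> real \<Rightarrow> real" where
  "flat_exp m t = (if t > 0 then inverse t ^ m / exp (inverse t) else 0)"

text \<open>From the right, the substitution \<open>u = 1/t\<close> turns this into the decay of
  \<open>u^m / exp u\<close> at infinity; from the left the function is identically
  \<open>0\<close>.\<close>

lemma flat_exp_tendsto: "(flat_exp m \<longlongrightarrow> 0) (at 0)"
proof -
  have "((\<lambda>t::real. inverse t ^ m / exp (inverse t)) \<longlongrightarrow> 0) (at_right 0)"
    by (rule filterlim_compose[OF tendsto_power_div_exp_0 filterlim_inverse_at_top_right])
  then have "(flat_exp m \<longlongrightarrow> 0) (at_right 0)"
    by (rule Lim_transform_eventually) (auto simp: flat_exp_def eventually_at_filter)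
  moreover have "((\<lambda>t. 0) \<longlongrightarrow> 0) (at_left (0::real))" by simp
  then have "(flat_exp m \<longlongrightarrow> 0) (at_left 0)"
    by (rule Lim_transform_eventually) (auto simp: flat_exp_def eventually_at_filter)
  ultimately show ?thesis by (simp add: filterlim_split_at)
qed

text \<open>Keeping the power \<open>m\<close> as a parameter makes the family closed under
  differentiation up to linear combinations, so that smoothness follows by an induction generalised
  over \<open>m\<close>.\<close>

lemma flat_exp_deriv:
  "(flat_exp m has_real_derivative (- real m) * flat_exp (Suc m) t + flat_exp (m + 2) t) (at t)"
proof (rule linorder_cases[of t 0])
  assume t: "t < 0"
  have "((\<lambda>t. 0) has_real_derivative 0) (at t)" by simp
  then have "(flat_exp m has_real_derivative 0) (at t)"
    by (rule DERIV_cong_ev[THEN iffD1, rotated -1])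
      (use t in \<open>auto simp: flat_exp_def eventually_nhds intro!: exI[of _ "{..<0}"]\<close>)
  then show ?thesis using t by (simp add: flat_exp_def)
next
  assume t: "t > 0"
  have "((\<lambda>t. inverse t ^ m / exp (inverse t)) has_real_derivative
     (- real m) * flat_exp (Suc m) t + flat_exp (m + 2) t) (at t)"
  proof -
    have 1: "(inverse has_real_derivative - (inverse t * inverse t)) (at t)"
      using DERIV_inverse[of t] t by (simp add: power2_eq_square)
    have 2: "((\<lambda>t. inverse t ^ m) has_real_derivative
        real m * (inverse t ^ (m - 1) * - (inverse t * inverse t))) (at t)"
      using DERIV_power[OF 1, of m] by (rule DERIV_cong) simp
    have "((\<lambda>t. inverse t ^ m / exp (inverse t)) has_real_derivative
        (real m * (inverse t ^ (m - 1) * - (inverse t * inverse t)) * exp (inverse t)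
          - inverse t ^ m * (exp (inverse t) * - (inverse t * inverse t)))
        / (exp (inverse t) * exp (inverse t))) (at t)"
      by (intro DERIV_divide 2 DERIV_fun_exp[OF 1]) simp
    then show ?thesis
      by (rule DERIV_cong) (use t in \<open>cases m; simp add: flat_exp_def field_simps\<close>)
  qed
  then show ?thesis
    by (rule DERIV_cong_ev[THEN iffD1, rotated -1])
      (use t in \<open>auto simp: flat_exp_def eventually_nhds intro!: exI[of _ "{0<..}"]\<close>)
next
  assume t: "t = 0"
  \<comment> \<open>The difference quotient of \<open>flat_exp m\<close> at \<open>0\<close> is
    exactly \<open>flat_exp (Suc m)\<close>, whose limit at \<open>0\<close> is already
    known.\<close>
  have "((\<lambda>h. (flat_exp m (0 + h) - flat_exp m 0) / h) \<longlongrightarrow> 0) (at 0)"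
    by (rule Lim_transform_eventually[OF flat_exp_tendsto[of "Suc m"]])
      (auto simp: flat_exp_def eventually_at_filter field_simps)
  then show ?thesis using t by (simp add: DERIV_def flat_exp_def)
qed

lemma smooth_flat_exp: "smooth (flat_exp m)"
proof -
  have "ndiff n (flat_exp m)" for n
  proof (induction n arbitrary: m)
    case (Suc n)
    show ?case
      by (rule ndiff_SucI[OF flat_exp_deriv]) (intro ndiff_add ndiff_mult ndiff_const Suc)
  qed simp
  then show ?thesis by (simp add: smooth_def)
qed

text \<open>Nesting two flat exponentials avoids any quotient. For \<open>s \<le> 1\<close> the
  inner one vanishes and the value is constant; at \<open>s = 2\<close> it reaches
  \<open>exp (- 1)\<close>, so from there on the outer argument is at most \<open>0\<close>. The
  plateau has height \<open>cutoff_top\<close>, which is positive but not \<open>1\<close>.\<close>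

definition cutoff :: "real \<Rightarrow> real" where
  "cutoff s = flat_exp 0 (exp (- 1) - flat_exp 0 (s - 1))"

definition cutoff_top :: real where
  "cutoff_top = flat_exp 0 (exp (- 1))"

lemma cutoff_top_pos: "cutoff_top > 0"
  by (simp add: cutoff_top_def flat_exp_def)

lemma cutoff_eq_top: "s \<le> 1 \<Longrightarrow> cutoff s = cutoff_top"
  by (simp add: cutoff_def cutoff_top_def flat_exp_def)

lemma cutoff_eq_0:
  assumes "s \<ge> 2" shows "cutoff s = 0"
proof -
  have "inverse (s - 1) \<le> 1" using assms by (simp add: field_simps)
  then have "exp (- 1) \<le> exp (- inverse (s - 1))" by simp
  then show ?thesis using assms by (simp add: cutoff_def flat_exp_def exp_minus field_simps)
qed

lemma cutoff_nonneg: "cutoff s \<ge> 0"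
  and cutoff_le_1: "cutoff s \<le> 1"
  by (simp_all add: cutoff_def flat_exp_def)

lemma smooth_cutoff: "smooth cutoff"
proof -
  have "smooth (\<lambda>s. flat_exp 0 (exp (- 1) + (- 1) * flat_exp 0 (s + (- 1))))"
    by (intro smooth_compose[OF smooth_flat_exp] smooth_add smooth_mult smooth_const smooth_id)
  then show ?thesis by (simp add: cutoff_def[abs_def])
qed

lemma deriv_eq_0_outside:
  fixes f :: "real \<Rightarrow> real"
  assumes "smooth f" "\<And>s. s < a \<Longrightarrow> f s = c" "\<And>s. s > b \<Longrightarrow> f s = 0"
  shows "s < a \<Longrightarrow> deriv f s = 0" "s > b \<Longrightarrow> deriv f s = 0"
proof -
  show "deriv f s = 0" if "s < a"
  proof (rule DERIV_imp_deriv, rule DERIV_cong_ev[THEN iffD1, rotated -1])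
    show "((\<lambda>s. c) has_real_derivative 0) (at s)" by simp
  qed (use that assms in \<open>auto simp: eventually_nhds intro!: exI[of _ "{..<a}"]\<close>)
  show "deriv f s = 0" if "s > b"
  proof (rule DERIV_imp_deriv, rule DERIV_cong_ev[THEN iffD1, rotated -1])
    show "((\<lambda>s. 0) has_real_derivative 0) (at s)" by simp
  qed (use that assms in \<open>auto simp: eventually_nhds intro!: exI[of _ "{b<..}"]\<close>)
qed

lemma smooth_bounded_interval:
  assumes "smooth f" obtains M where "\<And>s. s \<in> {a..b} \<Longrightarrow> \<bar>f s\<bar> \<le> M"
proof -
  have "bounded (f ` {a..b})"
    by (intro compact_imp_bounded compact_continuous_image smooth_continuous assms) simp
  then obtain M where "\<forall>y\<in>f ` {a..b}. norm y \<le> M" unfolding bounded_iff by blast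
  then show ?thesis using that[of M] by simp
qed

text \<open>Both derivatives are continuous and live on the compact transition interval, which gives
  one global bound \<open>M\<close>.\<close>

lemma cutoff_derivatives:
  obtains M where "M \<ge> 0" "\<And>s. \<bar>deriv cutoff s\<bar> \<le> M" "\<And>s. \<bar>deriv (deriv cutoff) s\<bar> \<le> M"
    "\<And>s. s \<notin> {1..2} \<Longrightarrow> deriv cutoff s = 0" "\<And>s. s \<notin> {1..2} \<Longrightarrow> deriv (deriv cutoff) s = 0"
proof -
  note sm = smooth_cutoff smooth_deriv(2)[OF smooth_cutoff]
  have z1: "deriv cutoff s = 0" if "s \<notin> {1..2}" for s
    using deriv_eq_0_outside[OF sm(1), of 1 cutoff_top 2 s] that
    by (force simp: cutoff_eq_top cutoff_eq_0)
  have z2: "deriv (deriv cutoff) s = 0" if "s \<notin> {1..2}" for s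
    using deriv_eq_0_outside[OF sm(2), of 1 0 2 s] that z1 by force
  obtain M1 where M1: "\<And>s. s \<in> {1..2} \<Longrightarrow> \<bar>deriv cutoff s\<bar> \<le> M1"
    using smooth_bounded_interval[OF sm(2), of 1 2] by metis
  obtain M2 where M2: "\<And>s. s \<in> {1..2} \<Longrightarrow> \<bar>deriv (deriv cutoff) s\<bar> \<le> M2"
    using smooth_bounded_interval[OF smooth_deriv(2)[OF sm(2)], of 1 2] by metis
  show ?thesis
  proof (rule that[of "max 0 (max M1 M2)"])
    show "\<bar>deriv cutoff s\<bar> \<le> max 0 (max M1 M2)" for s
      using M1[of s] z1[of s] by (cases "s \<in> {1..2}") auto
    show "\<bar>deriv (deriv cutoff) s\<bar> \<le> max 0 (max M1 M2)" for s
      using M2[of s] z2[of s] by (cases "s \<in> {1..2}") auto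
  qed (use z1 z2 in auto)
qed

section \<open>The spherical wave as an entire function of \<open>s = |x|^2\<close>\<close>

text \<open>\<open>sinc_coeff\<close> are the Taylor coefficients of \<open>sin (sqrt s) / sqrt s\<close> in the variable \<open>s\<close>.\<close>

definition sinc_coeff :: "nat \<Rightarrow> real" where
  "sinc_coeff n = (- 1) ^ n / fact (2 * n + 1)"

definition sinc_sqrt :: "real \<Rightarrow> real" where
  "sinc_sqrt s = (\<Sum>n. sinc_coeff n * s ^ n)"

text \<open>Since \<open>fact (2 * n + 1)\<close> dominates \<open>fact n\<close>, the exponential
  series is a majorant for every \<open>s\<close>.\<close>

lemma summable_sinc_coeff: "summable (\<lambda>n. sinc_coeff n * s ^ n)"
proof (rule summable_comparison_test')
  show "summable (\<lambda>n. inverse (fact n) * \<bar>s\<bar> ^ n)" by (rule summable_exp)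
  fix n :: nat
  have "fact n \<le> (fact (2 * n + 1) :: real)" by (rule fact_mono) simp
  then have "inverse (fact (2 * n + 1)) \<le> (inverse (fact n) :: real)"
    by (rule le_imp_inverse_le) simp
  then show "norm (sinc_coeff n * s ^ n) \<le> inverse (fact n) * \<bar>s\<bar> ^ n" if "n \<ge> 0"
    by (simp add: sinc_coeff_def abs_mult power_abs mult_right_mono divide_inverse del: fact_Suc)
qed

text \<open>The derivative is again an everywhere convergent power series, with coefficients
  \<open>diffs c\<close>; the induction therefore has to be generalised over
  \<open>c\<close>.\<close>

lemma smooth_power_series:
  fixes c :: "nat \<Rightarrow> real"
  assumes "\<And>s. summable (\<lambda>n. c n * s ^ n)"
  shows "smooth (\<lambda>s. \<Sum>n. c n * s ^ n)"
proof -
  have "ndiff k (\<lambda>s. \<Sum>n. c n * s ^ n)" for k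
    using assms
  proof (induction k arbitrary: c)
    case (Suc k)
    show ?case
    proof (rule ndiff_SucI)
      show "((\<lambda>s. \<Sum>n. c n * s ^ n) has_real_derivative (\<Sum>n. diffs c n * s ^ n)) (at s)" for s
        by (rule termdiffs_strong_converges_everywhere[OF Suc.prems])
      show "ndiff k (\<lambda>s. \<Sum>n. diffs c n * s ^ n)"
        by (rule Suc.IH) (rule termdiff_converges_all[OF Suc.prems])
    qed
  qed simp
  then show ?thesis by (simp add: smooth_def)
qed

lemma smooth_sinc_sqrt: "smooth sinc_sqrt"
  using smooth_power_series[OF summable_sinc_coeff] by (simp add: sinc_sqrt_def[abs_def])

lemma sinc_sqrt_0: "sinc_sqrt 0 = 1"
  using powser_zero[of sinc_coeff] by (simp add: sinc_sqrt_def) (simp add: sinc_coeff_def)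

lemma sinc_sqrt_square: "r * sinc_sqrt (r\<^sup>2) = sin r"
proof -
  have "(\<lambda>n. r * (sinc_coeff n * (r\<^sup>2) ^ n)) sums (r * sinc_sqrt (r\<^sup>2))"
    unfolding sinc_sqrt_def by (intro sums_mult summable_sums summable_sinc_coeff)
  moreover have "(\<lambda>n. r * (sinc_coeff n * (r\<^sup>2) ^ n)) = (\<lambda>n. (- 1) ^ n / fact (2 * n + 1) * r ^ (2 * n + 1))"
    by (simp add: sinc_coeff_def power_mult fun_eq_iff)
  ultimately show ?thesis using sin_paired[of r] sums_unique2 by metis
qed

text \<open>For nonzero \<open>r\<close>, differentiate \<open>r * sinc_sqrt (r^2) = sin r\<close>
  and compare with \<open>cos r\<close>; the resulting identity is then multiplied by nothing but
  rearranged. At \<open>r = 0\<close> both sides vanish.\<close>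

lemma sinc_sqrt_deriv_square: "2 * r\<^sup>2 * deriv sinc_sqrt (r\<^sup>2) = cos r - sinc_sqrt (r\<^sup>2)"
proof (cases "r = 0")
  case False
  have 1: "((\<lambda>r. r * sinc_sqrt (r\<^sup>2)) has_real_derivative
      1 * sinc_sqrt (r\<^sup>2) + deriv sinc_sqrt (r\<^sup>2) * (2 * r) * r) (at r)"
    by (intro DERIV_mult DERIV_ident DERIV_chain2[OF smooth_deriv(1)[OF smooth_sinc_sqrt]])
      (auto intro!: derivative_eq_intros)
  moreover have "(\<lambda>r. r * sinc_sqrt (r\<^sup>2)) = sin" by (rule ext) (rule sinc_sqrt_square)
  ultimately have "(sin has_real_derivative
      1 * sinc_sqrt (r\<^sup>2) + deriv sinc_sqrt (r\<^sup>2) * (2 * r) * r) (at r)" by simp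
  from DERIV_unique[OF this DERIV_sin] show ?thesis by (simp add: power2_eq_square algebra_simps)
qed (simp add: sinc_sqrt_0)

lemma sinc_sqrt_bound:
  assumes "s \<ge> 0" shows "\<bar>sinc_sqrt s\<bar> \<le> 1"
proof (cases "s = 0")
  case False
  define r where "r = sqrt s"
  have r: "r > 0" "s = r\<^sup>2" using assms False by (auto simp: r_def)
  have "\<bar>r\<bar> * \<bar>sinc_sqrt s\<bar> \<le> \<bar>r\<bar> * 1"
    using abs_sin_x_le_abs_x[of r] unfolding sinc_sqrt_square[of r, symmetric] r(2) by (simp add: abs_mult)
  then show ?thesis using r by simp
qed (simp add: sinc_sqrt_0)

text \<open>By the preceding identity, \<open>2 * s * deriv sinc_sqrt s\<close> is a difference of
  two quantities of modulus at most \<open>1\<close>. The factor \<open>s\<close> is what makes the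
  later estimates uniform in the energy.\<close>

lemma sinc_sqrt_deriv_bound:
  assumes "s \<ge> 0" shows "\<bar>s * deriv sinc_sqrt s\<bar> \<le> 1"
proof -
  have "2 * (s * deriv sinc_sqrt s) = cos (sqrt s) - sinc_sqrt s"
    using sinc_sqrt_deriv_square[of "sqrt s"] assms by simp
  then show ?thesis
    using sinc_sqrt_bound[OF assms] abs_cos_le_one[of "sqrt s"] unfolding abs_le_iff by linarith
qed

text \<open>This is the Helmholtz equation at energy \<open>1\<close> for a radial function in the
  variable \<open>s = |x|^2\<close>. It is checked on Taylor coefficients, which covers
  \<open>s = 0\<close> along with every other \<open>s\<close>.\<close>

lemma sinc_sqrt_ode:
  "4 * s * deriv (deriv sinc_sqrt) s + 6 * deriv sinc_sqrt s + sinc_sqrt s = 0"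
proof -
  let ?c = sinc_coeff
  have d1: "deriv sinc_sqrt = (\<lambda>s. \<Sum>n. diffs ?c n * s ^ n)"
    unfolding sinc_sqrt_def[abs_def]
    by (intro ext DERIV_imp_deriv termdiffs_strong_converges_everywhere summable_sinc_coeff)
  have s1: "summable (\<lambda>n. diffs ?c n * s ^ n)" for s
    by (rule termdiff_converges_all[OF summable_sinc_coeff])
  have d2: "deriv (deriv sinc_sqrt) = (\<lambda>s. \<Sum>n. diffs (diffs ?c) n * s ^ n)"
    unfolding d1 by (intro ext DERIV_imp_deriv termdiffs_strong_converges_everywhere s1)
  have s2: "summable (\<lambda>n. diffs (diffs ?c) n * s ^ n)" for s
    by (rule termdiff_converges_all[OF s1])
  have e: "s * deriv (deriv sinc_sqrt) s = (\<Sum>n. real n * diffs ?c n * s ^ n)"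
  proof -
    have "(\<lambda>n. s * (diffs (diffs ?c) n * s ^ n)) sums (s * deriv (deriv sinc_sqrt) s)"
      unfolding d2 by (intro sums_mult summable_sums s2)
    then have "(\<lambda>n. real (Suc n) * diffs ?c (Suc n) * s ^ Suc n) sums (s * deriv (deriv sinc_sqrt) s)"
      by (simp add: diffs_def[of "diffs ?c"] algebra_simps)
    \<comment> \<open>The shifted series lacks its term at \<open>n = 0\<close>, which is zero
      because of the factor \<open>real n\<close>.\<close>
    from sums_Suc[OF this] show ?thesis by (simp add: sums_iff)
  qed
  have se: "summable (\<lambda>n. real n * diffs ?c n * s ^ n)"
  proof -
    have "summable (\<lambda>n. s * (diffs (diffs ?c) n * s ^ n))" by (intro summable_mult s2)
    then have "summable (\<lambda>n. real (Suc n) * diffs ?c (Suc n) * s ^ Suc n)"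
      by (simp add: diffs_def[of "diffs ?c"] algebra_simps)
    then show ?thesis by (subst (asm) summable_Suc_iff)
  qed
  \<comment> \<open>Here \<open>diffs sinc_coeff n = (n + 1) c_(n+1)\<close>, and
    \<open>(n + 1) (4 n + 6) = (2 n + 2) (2 n + 3)\<close> is the ratio of consecutive factorials in
    \<open>sinc_coeff\<close>, whose sign alternates.\<close>
  have rec: "4 * (real n * diffs ?c n) + 6 * diffs ?c n + ?c n = 0" for n
    by (simp add: diffs_def sinc_coeff_def divide_simps) (simp add: algebra_simps)
  have "4 * (s * deriv (deriv sinc_sqrt) s) + 6 * deriv sinc_sqrt s + sinc_sqrt s
      = (\<Sum>n. 4 * (real n * diffs ?c n * s ^ n) + 6 * (diffs ?c n * s ^ n) + ?c n * s ^ n)"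
    unfolding e unfolding d1 sinc_sqrt_def
    by (intro sums_unique sums_add sums_mult summable_sums se s1 summable_sinc_coeff)
  also have "\<dots> = (\<Sum>n. (4 * (real n * diffs ?c n) + 6 * diffs ?c n + ?c n) * s ^ n)"
    by (simp add: algebra_simps)
  also have "\<dots> = 0" by (simp only: rec) simp
  finally show ?thesis by (simp add: algebra_simps)
qed

section \<open>Test functions and the classical Laplacian\<close>

lemma partial_eq: "(f has_derivative D) (at x) \<Longrightarrow> partial i f x = D (axis i 1)"
  unfolding partial_def by (metis frechet_derivative_at)

lemma Ck_SucI:
  assumes "\<And>x. (f has_derivative D x) (at x)" "\<And>i. Ck k (\<lambda>x. D x (axis i 1))"
  shows "Ck (Suc k) f"
proof -
  have "partial i f = (\<lambda>x. D x (axis i 1))" for i using partial_eq[OF assms(1)] by blast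
  then show ?thesis using assms by (auto simp: differentiable_def)
qed

lemma Ck_mono: "Ck (Suc k) f \<Longrightarrow> Ck k f"
proof (induction k arbitrary: f)
  case 0
  then show ?case
    by (auto intro!: differentiable_imp_continuous_on simp: differentiable_on_def)
qed simp

lemma Ck_const: "Ck k (\<lambda>x. c)"
proof (induction k arbitrary: c)
  case (Suc k)
  show ?case by (rule Ck_SucI[where D = "\<lambda>x h. 0"]) (auto intro: Suc)
qed simp

lemma Ck_add: "Ck k f \<Longrightarrow> Ck k g \<Longrightarrow> Ck k (\<lambda>x. f x + g x)"
proof (induction k arbitrary: f g)
  case (Suc k)
  have "(f has_derivative frechet_derivative f (at x)) (at x)"
       "(g has_derivative frechet_derivative g (at x)) (at x)" for x
    using Suc.prems by (simp_all add: frechet_derivative_works[symmetric])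
  from has_derivative_add[OF this] show ?case
  proof (rule Ck_SucI)
    show "Ck k (\<lambda>x. frechet_derivative f (at x) (axis i 1) + frechet_derivative g (at x) (axis i 1))" for i
      using Suc.IH[of "partial i f" "partial i g"] Suc.prems by (simp add: partial_def)
  qed
qed (simp add: continuous_on_add)

lemma Ck_mult: "Ck k f \<Longrightarrow> Ck k g \<Longrightarrow> Ck k (\<lambda>x. f x * g x)"
proof (induction k arbitrary: f g)
  case (Suc k)
  have "(f has_derivative frechet_derivative f (at x)) (at x)"
       "(g has_derivative frechet_derivative g (at x)) (at x)" for x
    using Suc.prems by (simp_all add: frechet_derivative_works[symmetric])
  from has_derivative_mult[OF this] show ?case
  proof (rule Ck_SucI)
    show "Ck k (\<lambda>x. f x * frechet_derivative g (at x) (axis i 1) + frechet_derivative f (at x) (axis i 1) * g x)" for i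
      using Ck_add[OF Suc.IH[OF Ck_mono[OF Suc.prems(1)], of "partial i g"]
          Suc.IH[OF _ Ck_mono[OF Suc.prems(2)], of "partial i f"]] Suc.prems
      by (simp add: partial_def)
  qed
qed (simp add: continuous_on_mult)

lemma Ck_coordinate: "Ck k (\<lambda>x. complex_of_real (x $ i))"
proof (cases k)
  case 0
  then show ?thesis by (auto intro!: continuous_intros)
next
  case (Suc m)
  have "((\<lambda>x. complex_of_real (x $ i)) has_derivative (\<lambda>h. complex_of_real (h $ i))) (at x)" for x
    by (intro derivative_intros bounded_linear.has_derivative[OF bounded_linear_vec_nth])
  then show ?thesis unfolding Suc by (rule Ck_SucI) (rule Ck_const)
qed

lemma has_derivative_radial:
  fixes x :: "real ^ 3"
  assumes "(F has_real_derivative d) (at (x \<bullet> x))"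
  shows "((\<lambda>x. complex_of_real (F (x \<bullet> x))) has_derivative (\<lambda>h. of_real (d * (2 * (x \<bullet> h))))) (at x)"
proof -
  have "((\<lambda>x. x \<bullet> x) has_derivative (\<lambda>h. 2 * (x \<bullet> h))) (at x)"
    by (auto intro!: derivative_eq_intros simp: inner_commute)
  from has_derivative_compose[OF this assms[unfolded has_field_derivative_def]]
  show ?thesis by (intro derivative_intros)
qed

lemma partial_radial:
  assumes "\<And>s. s \<ge> 0 \<Longrightarrow> (F has_real_derivative F' s) (at s)"
  shows "partial i (\<lambda>x. complex_of_real (F (x \<bullet> x))) = (\<lambda>x. of_real (x $ i) * of_real (2 * F' (x \<bullet> x)))"
  by (rule ext, subst partial_eq[OF has_derivative_radial[OF assms]])
    (simp_all add: inner_axis)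

text \<open>Each partial derivative is a coordinate times the radial function with profile
  \<open>2 * deriv F\<close>, so the induction closes under products. One extra order of
  \<open>ndiff\<close> pays for continuity at \<open>k = 0\<close>.\<close>

lemma Ck_radial: "ndiff (Suc k) F \<Longrightarrow> Ck k (\<lambda>x. complex_of_real (F (x \<bullet> x)))"
proof (induction k arbitrary: F)
  case 0
  then have "continuous_on UNIV F"
    by (meson DERIV_continuous_on has_field_derivative_at_within ndiff_SucD(1))
  then show ?case
    by (auto intro!: continuous_intros continuous_on_compose2[of UNIV F])
next
  case (Suc k)
  have "ndiff (Suc k) (\<lambda>s. 2 * deriv F s)"
    by (rule ndiff_mult[OF ndiff_const ndiff_SucD(2)[OF Suc.prems]])
  from Ck_mult[OF Ck_coordinate Suc.IH[OF this]]
  have "Ck k (partial i (\<lambda>x. complex_of_real (F (x \<bullet> x))))" for i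
    by (subst partial_radial[OF ndiff_SucD(1)[OF Suc.prems]])
  then show ?case
    using has_derivative_radial[OF ndiff_SucD(1)[OF Suc.prems]] by (auto simp: differentiable_def)
qed

text \<open>The profile \<open>(1 + s) powr a\<close> is not smooth on the whole line, so
  \<open>Ck_radial\<close> does not apply. Derivatives at \<open>s \<ge> 0\<close> suffice, and
  differentiation only lowers the exponent by one; hence the induction over arbitrary
  \<open>a\<close>.\<close>

lemma Ck_weight: "Ck k (\<lambda>x. complex_of_real ((1 + x \<bullet> x) powr a))"
proof (induction k arbitrary: a)
  case 0
  have "1 + x \<bullet> x \<noteq> 0" for x :: "real ^ 3" using inner_ge_zero[of x] by linarith
  then show ?case by (auto intro!: continuous_intros)
next
  case (Suc k)
  let ?F = "\<lambda>s::real. (1 + s) powr a"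
  have d: "(?F has_real_derivative a * (1 + s) powr (a - 1)) (at s)" if "s \<ge> 0" for s
    using that by (auto intro!: derivative_eq_intros simp: powr_diff field_simps)
  have "Ck k (partial i (\<lambda>x. complex_of_real (?F (x \<bullet> x))))" for i
    using Ck_mult[OF Ck_coordinate Ck_mult[OF Ck_const Suc.IH], of i "of_real (2 * a)" "a - 1"]
    by (subst partial_radial[OF d]) (simp_all add: mult_ac)
  then show ?case
    using has_derivative_radial[OF d[OF inner_ge_zero]] by (auto simp: differentiable_def)
qed

lemma test_functionsI:
  assumes "\<And>k. Ck k f" "\<And>x. norm x > r \<Longrightarrow> f x = 0"
  shows "f \<in> test_functions"
proof -
  have "{x. f x \<noteq> 0} \<subseteq> cball 0 r" using assms(2) by (force simp: not_less)
  then have "bounded {x. f x \<noteq> 0}" using bounded_cball bounded_subset by blast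
  then show ?thesis using assms(1) by (simp add: test_functions_def)
qed

lemma test_functionsE:
  assumes "f \<in> test_functions"
  obtains r where "\<And>k. Ck k f" "\<And>x. norm x > r \<Longrightarrow> f x = 0" "r > 0"
proof -
  have "bounded {x. f x \<noteq> 0}" using assms compact_closure by (auto simp: test_functions_def)
  then obtain r where "r > 0" "\<forall>x\<in>{x. f x \<noteq> 0}. norm x \<le> r" using bounded_normE by metis
  then show ?thesis using that[of r] assms by (force simp: test_functions_def)
qed

lemma test_continuous: "f \<in> test_functions \<Longrightarrow> continuous_on S f"
  unfolding test_functions_def using Ck.simps(1) continuous_on_subset by blast

lemma test_differentiable: "f \<in> test_functions \<Longrightarrow> f differentiable (at x)"
  unfolding test_functions_def using Ck.simps(2) by blast

lemma test_mult:
  assumes "\<And>k. Ck k f" "g \<in> test_functions"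
  shows "(\<lambda>x. f x * g x) \<in> test_functions"
proof -
  obtain r where "\<And>k. Ck k g" "\<And>x. norm x > r \<Longrightarrow> g x = 0" using assms(2) test_functionsE by metis
  then show ?thesis using assms(1) by (intro test_functionsI[of _ r] Ck_mult) auto
qed

lemma test_Ck: "f \<in> test_functions \<Longrightarrow> Ck k f"
  by (simp add: test_functions_def)

lemma test_add:
  assumes "f \<in> test_functions" "g \<in> test_functions"
  shows "(\<lambda>x. f x + g x) \<in> test_functions"
proof -
  obtain r where r: "\<And>x. norm x > r \<Longrightarrow> f x = 0" using assms(1) test_functionsE by metis
  obtain r' where r': "\<And>x. norm x > r' \<Longrightarrow> g x = 0" using assms(2) test_functionsE by metis
  show ?thesis
  proof (rule test_functionsI[of _ "max r r'"])
    show "Ck k (\<lambda>x. f x + g x)" for k using assms by (intro Ck_add test_Ck)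
  qed (use r r' in simp)
qed

lemma test_scale: "f \<in> test_functions \<Longrightarrow> (\<lambda>x. c * f x) \<in> test_functions"
  by (rule test_mult[OF Ck_const])

lemma test_zero: "(\<lambda>x. 0) \<in> test_functions"
  by (rule test_functionsI) (auto intro: Ck_const)

lemma test_sum: "(\<And>j. j \<in> A \<Longrightarrow> f j \<in> test_functions) \<Longrightarrow> (\<lambda>x. \<Sum>j\<in>A. f j x) \<in> test_functions"
  by (induction A rule: infinite_finite_induct) (auto intro: test_zero test_add)

lemma test_partial:
  assumes "f \<in> test_functions"
  shows "partial i f \<in> test_functions"
proof -
  obtain r where r: "\<And>k. Ck k f" "\<And>x. norm x > r \<Longrightarrow> f x = 0" "r > 0"
    using assms test_functionsE by metis
  show ?thesis
  proof (rule test_functionsI)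
    show "Ck k (partial i f)" for k using r(1)[of "Suc k"] by simp
    fix x :: "real ^ 3" assume x: "norm x > r"
    have "open {x :: real ^ 3. norm x > r}" by (intro open_Collect_less continuous_intros)
    then have "(f has_derivative (\<lambda>h. 0)) (at x)"
      by (rule has_derivative_transform_within_open[of "\<lambda>x. 0", rotated]) (use x r in auto)
    then show "partial i f x = 0" by (simp add: partial_eq)
  qed
qed

lemma test_bounded:
  assumes "f \<in> test_functions"
  obtains K where "\<And>x. norm (f x) \<le> K"
proof -
  obtain r where r: "\<And>x. norm x > r \<Longrightarrow> f x = 0" "r > 0"
    using assms test_functionsE by metis
  have "bounded (f ` cball 0 r)"
    by (intro compact_imp_bounded compact_continuous_image test_continuous assms compact_cball)
  then obtain K where K: "\<forall>y\<in>f ` cball 0 r. norm y \<le> K" unfolding bounded_iff by blast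
  have "norm (f x) \<le> max K 0" for x
    using K r(1)[of x] by (cases "norm x > r") (simp_all add: le_max_iff_disj)
  then show ?thesis using that by blast
qed

lemma integrable_compact_support:
  fixes f :: "'a::euclidean_space \<Rightarrow> 'b::{banach, second_countable_topology}"
  assumes "continuous_on UNIV f" "\<And>x. norm x > r \<Longrightarrow> f x = 0"
  shows "integrable lborel f"
proof -
  have "integrable lborel (\<lambda>x. indicator (cball 0 r) x *\<^sub>R f x)"
    by (rule borel_integrable_compact) (use assms in \<open>auto intro: continuous_on_subset\<close>)
  moreover have "(\<lambda>x. indicator (cball 0 r) x *\<^sub>R f x) = f"
    using assms(2) by (force simp: indicator_def fun_eq_iff not_le)
  ultimately show ?thesis by simp
qed

lemma test_integrable:
  assumes "f \<in> test_functions" shows "integrable lborel f"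
proof -
  obtain r where r: "\<And>x. norm x > r \<Longrightarrow> f x = 0" using assms test_functionsE by metis
  show ?thesis by (rule integrable_compact_support[OF test_continuous[OF assms] r])
qed

lemma test_measurable: "f \<in> test_functions \<Longrightarrow> f \<in> borel_measurable lborel"
  by (rule borel_measurable_integrable[OF test_integrable])

lemma test_L2:
  assumes "f \<in> test_functions" shows "f \<in> L2"
proof -
  obtain r where r: "\<And>x. norm x > r \<Longrightarrow> f x = 0" using assms test_functionsE by metis
  have "integrable lborel (\<lambda>x. (cmod (f x))\<^sup>2)"
  proof (rule integrable_compact_support)
    show "continuous_on UNIV (\<lambda>x. (cmod (f x))\<^sup>2)"
      by (intro continuous_intros test_continuous assms)
  qed (use r in simp)
  then show ?thesis using test_measurable[OF assms] by (simp add: L2_def)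
qed

section \<open>Integration by parts for test functions\<close>

lemma integral_lborel_translation:
  fixes f :: "'a::euclidean_space \<Rightarrow> 'b::{banach, second_countable_topology}"
  assumes "f \<in> borel_measurable borel"
  shows "(LINT x|lborel. f (c + x)) = (LINT x|lborel. f x)"
proof -
  have "(LINT x|lborel. f x) = (LINT x|distr lborel borel ((+) c). f x)"
    by (simp add: lborel_distr_plus)
  also have "\<dots> = (LINT x|lborel. f (c + x))"
    by (rule integral_distr) (use assms in auto)
  finally show ?thesis by simp
qed

text \<open>By translation invariance every difference quotient of \<open>f\<close> has integral
  zero, and dominated convergence passes this to the derivative.\<close>

lemma integral_partial:
  assumes f: "f \<in> test_functions"
  shows "(LINT x|lborel. partial i f x) = 0"
proof -
  define e :: "real ^ 3" where "e = axis i 1"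
  define h where "h n = inverse (real (Suc n))" for n
  define d where "d n x = (f (h n *\<^sub>R e + x) - f x) /\<^sub>R h n" for n x
  obtain r where r: "\<And>x. norm x > r \<Longrightarrow> f x = 0" "r > 0" using f test_functionsE by metis
  obtain K where K: "\<And>x. norm (partial i f x) \<le> K" using test_bounded[OF test_partial[OF f]] by metis
  have h: "h n > 0" "h n \<le> 1" for n by (simp_all add: h_def field_simps)
  have deriv: "((\<lambda>t. f (t *\<^sub>R e + x)) has_derivative (\<lambda>s. s *\<^sub>R partial i f (t *\<^sub>R e + x))) (at t)" for t x
  proof -
    have D: "(f has_derivative frechet_derivative f (at (t *\<^sub>R e + x))) (at (t *\<^sub>R e + x))"
      using frechet_derivative_works test_differentiable[OF f] by blast
    have "((\<lambda>t. t *\<^sub>R e + x) has_derivative (\<lambda>s. s *\<^sub>R e)) (at t)"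
      by (auto intro!: derivative_eq_intros)
    from has_derivative_compose[OF this D]
    show ?thesis
      by (simp only: linear_cmul[OF has_derivative_linear[OF D]] partial_def e_def[symmetric])
  qed
  \<comment> \<open>The mean value inequality bounds the quotient by the supremum \<open>K\<close>
    of the derivative. Since the step \<open>h n\<close> is at most \<open>1\<close>, all quotients
    vanish outside the ball of radius \<open>r + 1\<close>, so the majorant is independent of
    \<open>n\<close>.\<close>
  have bound: "norm (d n x) \<le> indicator (cball 0 (r + 1)) x *\<^sub>R K" for n x
  proof (cases "norm x \<le> r + 1")
    case True
    have "\<exists>t\<in>{0<..<h n}. norm (f (h n *\<^sub>R e + x) - f (0 *\<^sub>R e + x))
        \<le> norm ((h n - 0) *\<^sub>R partial i f (t *\<^sub>R e + x))"
    proof (rule mvt_general)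
      show "continuous_on {0..h n} (\<lambda>t. f (t *\<^sub>R e + x))"
        by (intro continuous_on_compose2[OF test_continuous[OF f, of UNIV]] continuous_intros) auto
    qed (use h deriv in auto)
    then obtain t where "norm (f (h n *\<^sub>R e + x) - f x) \<le> h n * norm (partial i f (t *\<^sub>R e + x))"
      using h[of n] by auto
    also have "\<dots> \<le> h n * K" using h[of n] K by (intro mult_left_mono) auto
    finally have "norm (f (h n *\<^sub>R e + x) - f x) / h n \<le> K"
      using h[of n] by (simp add: pos_divide_le_eq mult.commute)
    moreover have "norm (d n x) = norm (f (h n *\<^sub>R e + x) - f x) / h n"
      using h[of n] by (simp only: d_def norm_scaleR) (simp add: divide_inverse mult.commute)
    ultimately show ?thesis using True by simp
  next
    case False
    have "norm x \<le> norm (h n *\<^sub>R e + x) + norm (h n *\<^sub>R e)"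
      using norm_triangle_ineq4[of "h n *\<^sub>R e + x" "h n *\<^sub>R e"] by simp
    then have "norm x \<le> norm (h n *\<^sub>R e + x) + 1" using h[of n] by (simp add: e_def)
    then show ?thesis using False r by (simp add: d_def)
  qed
  have "(\<lambda>n. LINT x|lborel. d n x) \<longlonglongrightarrow> (LINT x|lborel. partial i f x)"
  proof (rule integral_dominated_convergence)
    show "integrable lborel (\<lambda>x::real^3. indicator (cball 0 (r + 1)) x *\<^sub>R K)"
      by (rule borel_integrable_compact) auto
    show "AE x in lborel. norm (d n x) \<le> indicator (cball 0 (r + 1)) x *\<^sub>R K" for n
      using bound by simp
    have hlim: "filterlim h (at 0) sequentially"
      unfolding filterlim_at h_def using LIMSEQ_inverse_real_of_nat by auto
    have "(\<lambda>n. d n x) \<longlonglongrightarrow> partial i f x" for x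
    proof -
      have "((\<lambda>t. f (t *\<^sub>R e + x)) has_vector_derivative partial i f (0 *\<^sub>R e + x)) (at 0)"
        using deriv[of x 0] by (simp add: has_vector_derivative_def)
      then have "((\<lambda>t. norm (f (t *\<^sub>R e + x) - f x - t *\<^sub>R partial i f x) / norm t) \<longlongrightarrow> 0) (at 0)"
        by (simp add: has_vector_derivative_def has_derivative_at)
      then have "((\<lambda>t. norm ((f (t *\<^sub>R e + x) - f x) /\<^sub>R t - partial i f x)) \<longlongrightarrow> 0) (at 0)"
      proof (rule Lim_transform_eventually)
        have "norm (f (t *\<^sub>R e + x) - f x - t *\<^sub>R partial i f x) / norm t
            = norm ((f (t *\<^sub>R e + x) - f x) /\<^sub>R t - partial i f x)" if "t \<noteq> 0" for t
        proof -
          have "(f (t *\<^sub>R e + x) - f x) /\<^sub>R t - partial i f x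
              = (f (t *\<^sub>R e + x) - f x - t *\<^sub>R partial i f x) /\<^sub>R t"
            using that by (simp add: scaleR_diff_right)
          then show ?thesis by (simp add: divide_inverse mult.commute)
        qed
        then show "\<forall>\<^sub>F t in at 0. norm (f (t *\<^sub>R e + x) - f x - t *\<^sub>R partial i f x) / norm t
            = norm ((f (t *\<^sub>R e + x) - f x) /\<^sub>R t - partial i f x)"
          by (auto simp: eventually_at_filter)
      qed
      then have "((\<lambda>t. (f (t *\<^sub>R e + x) - f x) /\<^sub>R t) \<longlongrightarrow> partial i f x) (at 0)"
        by (simp add: tendsto_norm_zero_iff LIM_zero_iff)
      from filterlim_compose[OF this hlim] show ?thesis by (simp add: d_def)
    qed
    then show "AE x in lborel. (\<lambda>n. d n x) \<longlonglongrightarrow> partial i f x" by simp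
    have [measurable]: "f \<in> borel_measurable borel" using test_measurable[OF f] by simp
    show "d n \<in> borel_measurable lborel" for n unfolding d_def by measurable
    show "partial i f \<in> borel_measurable lborel" by (rule test_measurable[OF test_partial[OF f]])
  qed
  moreover have "(LINT x|lborel. d n x) = 0" for n
  proof -
    have [measurable]: "f \<in> borel_measurable borel" using test_measurable[OF f] by simp
    have "integrable lborel (\<lambda>x. f (h n *\<^sub>R e + x))"
      using test_integrable[OF f] lborel_distr_plus[of "h n *\<^sub>R e"]
      by (subst integrable_distr_eq[symmetric, where g = "(+) (h n *\<^sub>R e)" and N = borel]) auto
    then show ?thesis
      unfolding d_def
      by (simp add: integral_lborel_translation test_integrable[OF f] del: inverse_eq_divide)
  qed
  ultimately show ?thesis by (simp add: LIMSEQ_const_iff)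
qed

lemma partial_mult:
  assumes "f differentiable (at x)" "g differentiable (at x)"
  shows "partial i (\<lambda>x. f x * g x) x = f x * partial i g x + partial i f x * g x"
  using partial_eq[OF has_derivative_mult[OF frechet_derivative_works[THEN iffD1, OF assms(1)]
        frechet_derivative_works[THEN iffD1, OF assms(2)]]]
  by (simp add: partial_def)

text \<open>Integrate the product rule for \<open>v * \<phi>\<close>: the left-hand side is the
  integral of a derivative of a test function, hence zero.\<close>

lemma weak_partial_test:
  assumes "v \<in> test_functions"
  shows "weak_partial i v (partial i v)"
  unfolding weak_partial_def
proof
  fix \<phi> assume \<phi>: "\<phi> \<in> test_functions"
  have "0 = (LINT x|lborel. partial i (\<lambda>x. v x * \<phi> x) x)"
    using assms \<phi> by (intro integral_partial[symmetric] test_mult test_Ck)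
  also have "\<dots> = (LINT x|lborel. v x * partial i \<phi> x + partial i v x * \<phi> x)"
    by (simp add: partial_mult assms \<phi> test_differentiable)
  also have "\<dots> = (LINT x|lborel. v x * partial i \<phi> x) + (LINT x|lborel. partial i v x * \<phi> x)"
    using assms \<phi>
    by (intro Bochner_Integration.integral_add test_integrable test_mult test_Ck test_partial)
  finally show "(LINT x|lborel. v x * partial i \<phi> x) = - (LINT x|lborel. partial i v x * \<phi> x)"
    by (simp add: eq_neg_iff_add_eq_0)
qed

section \<open>The classical Laplacian of test functions and of radial functions\<close>

definition laplacian :: "R3_fun \<Rightarrow> R3_fun" where
  "laplacian v = (\<lambda>x. \<Sum>i\<in>UNIV. partial i (partial i v) x)"

lemma test_laplacian: "v \<in> test_functions \<Longrightarrow> laplacian v \<in> test_functions"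
  unfolding laplacian_def by (rule test_sum) (simp add: test_partial)

lemma test_H2:
  assumes "v \<in> test_functions" shows "v \<in> H2"
proof -
  have "\<exists>u\<in>L2. weak_partial i v u \<and> (\<forall>j. \<exists>w\<in>L2. weak_partial j u w)" for i
  proof (rule bexI[of _ "partial i v"], intro conjI allI)
    show "\<exists>w\<in>L2. weak_partial j (partial i v) w" for j
      by (rule bexI[where x = "partial j (partial i v)"])
        (intro weak_partial_test test_L2 test_partial assms)+
  qed (intro weak_partial_test test_L2 test_partial assms)+
  then show ?thesis using test_L2[OF assms] by (simp add: H2_def)
qed

text \<open>Integration by parts is applied twice in each coordinate, and the two signs
  cancel.\<close>

lemma weak_laplacian_test:
  assumes "v \<in> test_functions"
  shows "weak_laplacian v (laplacian v)"
  unfolding weak_laplacian_def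
proof
  fix \<phi> assume \<phi>: "\<phi> \<in> test_functions"
  have "(LINT x|lborel. v x * partial i (partial i \<phi>) x) = (LINT x|lborel. partial i (partial i v) x * \<phi> x)" for i
    using weak_partial_test[OF assms, of i] weak_partial_test[OF test_partial[OF assms, of i], of i]
      \<phi> test_partial[OF \<phi>, of i] by (simp add: weak_partial_def)
  moreover have "integrable lborel (\<lambda>x. v x * partial i (partial i \<phi>) x)"
    "integrable lborel (\<lambda>x. partial i (partial i v) x * \<phi> x)" for i
    using assms \<phi> by (auto intro!: test_integrable test_mult test_partial test_Ck)
  ultimately show "(LINT x|lborel. v x * (\<Sum>i\<in>UNIV. partial i (partial i \<phi>) x))
      = (LINT x|lborel. laplacian v x * \<phi> x)"
    by (simp add: laplacian_def sum_distrib_left sum_distrib_right)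
qed

text \<open>Each second partial contributes \<open>4 * x_i^2 * F'' + 2 * F'\<close>; the coefficient
  \<open>6\<close> is twice the dimension.\<close>

lemma laplacian_radial:
  assumes "\<And>s. (F has_real_derivative F' s) (at s)" "\<And>s. (F' has_real_derivative F'' s) (at s)"
  shows "laplacian (\<lambda>x. complex_of_real (F (x \<bullet> x)))
     = (\<lambda>x. of_real (4 * (x \<bullet> x) * F'' (x \<bullet> x) + 6 * F' (x \<bullet> x)))"
proof
  fix x :: "real ^ 3"
  have 1: "partial i (partial i (\<lambda>x. complex_of_real (F (x \<bullet> x)))) x
      = of_real (4 * (x $ i)\<^sup>2 * F'' (x \<bullet> x) + 2 * F' (x \<bullet> x))" for i
  proof -
    have "((\<lambda>s. 2 * F' s) has_real_derivative 2 * F'' s) (at s)" for s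
      by (rule DERIV_cmult[OF assms(2)])
    note d = has_derivative_radial[OF this, of x]
    have c: "((\<lambda>x. complex_of_real (x $ i)) has_derivative (\<lambda>h. complex_of_real (h $ i))) (at x)"
      by (intro derivative_intros bounded_linear.has_derivative[OF bounded_linear_vec_nth])
    show ?thesis
      unfolding partial_radial[OF assms(1)] partial_eq[OF has_derivative_mult[OF c d]]
      by (simp add: inner_axis power2_eq_square algebra_simps)
  qed
  have "(\<Sum>i\<in>UNIV. 4 * (x $ i)\<^sup>2 * F'' (x \<bullet> x) + 2 * F' (x \<bullet> x)) = 4 * (x \<bullet> x) * F'' (x \<bullet> x) + 6 * F' (x \<bullet> x)"
    by (simp add: sum.distrib inner_vec_def power2_eq_square sum_distrib_left sum_distrib_right)
  then show "laplacian (\<lambda>x. complex_of_real (F (x \<bullet> x))) x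
      = of_real (4 * (x \<bullet> x) * F'' (x \<bullet> x) + 6 * F' (x \<bullet> x))"
    unfolding laplacian_def 1 by (metis of_real_sum)
qed

section \<open>Consequences of a bound on the weighted resolvent\<close>

lemma japanese_bracket_powr: "japanese_bracket x powr a = (1 + x \<bullet> x) powr (a / 2)"
proof -
  have "japanese_bracket x = (1 + x \<bullet> x) powr (1 / 2)"
    unfolding japanese_bracket_def
    by (subst powr_half_sqrt) (simp_all add: power2_norm_eq_inner add_nonneg_nonneg)
  then show ?thesis by (simp add: powr_powr)
qed

section \<open>Norms, the bilinear pairing and operator bounds in L2\<close>

lemma L2_norm_nonneg: "L2_norm f \<ge> 0"
  by (simp add: L2_norm_def)

lemma L2_norm_square: "(L2_norm f)\<^sup>2 = (LINT x|lborel. (cmod (f x))\<^sup>2)"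
  by (simp add: L2_norm_def)

lemma L2_scale: "f \<in> L2 \<Longrightarrow> (\<lambda>x. c * f x) \<in> L2"
  by (auto simp: L2_def norm_mult power_mult_distrib)

lemma L2_norm_scale: "L2_norm (\<lambda>x. c * f x) = cmod c * L2_norm f"
  by (simp add: L2_norm_def norm_mult power_mult_distrib real_sqrt_mult)

lemma L2_norm_cong:
  assumes "f \<in> L2" "g \<in> L2" "L2_eq f g"
  shows "L2_norm f = L2_norm g"
  unfolding L2_norm_def
proof (intro arg_cong[where f = sqrt] integral_cong_AE)
  show "AE x in lborel. (cmod (f x))\<^sup>2 = (cmod (g x))\<^sup>2"
    using assms(3) unfolding L2_eq_def by eventually_elim simp
qed (use assms in \<open>auto simp: L2_def\<close>)

lemma L2_mult_integrable:
  assumes "f \<in> L2" "g \<in> L2"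
  shows "integrable lborel (\<lambda>x. f x * g x)"
proof (rule Bochner_Integration.integrable_bound)
  show "integrable lborel (\<lambda>x. (cmod (f x))\<^sup>2 + (cmod (g x))\<^sup>2)"
    using assms by (auto simp: L2_def)
  show "(\<lambda>x. f x * g x) \<in> borel_measurable lborel"
    using assms by (auto simp: L2_def)
  have "norm (f x * g x) \<le> norm ((cmod (f x))\<^sup>2 + (cmod (g x))\<^sup>2)" for x
  proof -
    have "2 * (cmod (f x) * cmod (g x)) \<le> (cmod (f x))\<^sup>2 + (cmod (g x))\<^sup>2"
      using sum_squares_bound[of "cmod (f x)" "cmod (g x)"] by (simp add: mult_ac)
    moreover have "0 \<le> cmod (f x) * cmod (g x)" by simp
    ultimately show ?thesis unfolding norm_mult real_norm_def by linarith
  qed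
  then show "AE x in lborel. norm (f x * g x) \<le> norm ((cmod (f x))\<^sup>2 + (cmod (g x))\<^sup>2)" by simp
qed

text \<open>The pairing is bilinear, without conjugation, as in the weak formulations. The
  inequality is transferred from nonnegative integrals of the moduli.\<close>

lemma L2_Cauchy_Schwarz:
  assumes "f \<in> L2" "g \<in> L2"
  shows "cmod (LINT x|lborel. f x * g x) \<le> L2_norm f * L2_norm g"
proof -
  have [measurable]: "f \<in> borel_measurable borel" "g \<in> borel_measurable borel"
    using assms by (auto simp: L2_def)
  have int: "integrable lborel (\<lambda>x. cmod (f x) * cmod (g x))"
    using L2_mult_integrable[OF assms] integrable_norm by (force simp: norm_mult)
  have nn: "(\<integral>\<^sup>+x. (ennreal (cmod (h x)))\<^sup>2 \<partial>lborel) = ennreal ((L2_norm h)\<^sup>2)" if "h \<in> L2" for h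
    using that by (simp add: L2_norm_square ennreal_power L2_def nn_integral_eq_integral)
  have "(LINT x|lborel. cmod (f x) * cmod (g x))\<^sup>2 \<le> (L2_norm f)\<^sup>2 * (L2_norm g)\<^sup>2"
  proof -
    have "ennreal ((LINT x|lborel. cmod (f x) * cmod (g x))\<^sup>2)
        = (\<integral>\<^sup>+x. ennreal (cmod (f x)) * ennreal (cmod (g x)) \<partial>lborel)\<^sup>2"
      using nn_integral_eq_integral[OF int] by (simp add: ennreal_mult' ennreal_power)
    also have "\<dots> \<le> (\<integral>\<^sup>+x. (ennreal (cmod (f x)))\<^sup>2 \<partial>lborel) * (\<integral>\<^sup>+x. (ennreal (cmod (g x)))\<^sup>2 \<partial>lborel)"
      by (rule Cauchy_Schwarz_nn_integral) measurable
    also have "\<dots> = ennreal ((L2_norm f)\<^sup>2 * (L2_norm g)\<^sup>2)"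
      by (simp add: nn assms ennreal_mult)
    finally show ?thesis by (simp add: ennreal_le_iff)
  qed
  then have "(LINT x|lborel. cmod (f x) * cmod (g x)) \<le> L2_norm f * L2_norm g"
    unfolding power_mult_distrib[symmetric]
    by (rule power2_le_imp_le) (intro mult_nonneg_nonneg L2_norm_nonneg)
  moreover have "cmod (LINT x|lborel. f x * g x) \<le> (LINT x|lborel. cmod (f x) * cmod (g x))"
    using integral_norm_bound[of lborel "\<lambda>x. f x * g x"] by (simp add: norm_mult)
  ultimately show ?thesis by linarith
qed

text \<open>Homogeneity reduces the claim to the unit ball, where the norm is a supremum. The
  constant \<open>B\<close> from boundedness serves two purposes: it makes the set bounded above, so
  that the supremum is an upper bound, and it settles the case \<open>L2_norm f = 0\<close>, where
  normalising is impossible.\<close>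

lemma L2_norm_operator_bound:
  assumes T: "bounded_L2_operator T" and C: "L2_operator_norm T \<le> C" and f: "f \<in> L2"
  shows "L2_norm (T f) \<le> C * L2_norm f"
proof -
  obtain B where B: "\<And>f. f \<in> L2 \<Longrightarrow> L2_norm (T f) \<le> B * L2_norm f"
    using T unfolding bounded_L2_operator_def by blast
  show ?thesis
  proof (cases "L2_norm f = 0")
    case True
    then show ?thesis using B[OF f] by simp
  next
    case False
    define c where "c = complex_of_real (inverse (L2_norm f))"
    have pos: "L2_norm f > 0" using False L2_norm_nonneg[of f] by linarith
    have cn: "cmod c = inverse (L2_norm f)" using pos by (simp add: c_def norm_inverse)
    let ?h = "\<lambda>x. c * f x"
    have h: "?h \<in> L2" "L2_norm ?h \<le> 1" using f pos by (simp_all add: L2_scale L2_norm_scale cn)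
    have "L2_norm (T ?h) \<le> L2_operator_norm T"
      unfolding L2_operator_norm_def
    proof (rule cSup_upper)
      show "L2_norm (T ?h) \<in> {L2_norm (T f) |f. f \<in> L2 \<and> L2_norm f \<le> 1}" using h by blast
      show "bdd_above {L2_norm (T f) |f. f \<in> L2 \<and> L2_norm f \<le> 1}"
      proof (rule bdd_aboveI)
        fix y assume "y \<in> {L2_norm (T f) |f. f \<in> L2 \<and> L2_norm f \<le> 1}"
        then obtain g where g: "g \<in> L2" "L2_norm g \<le> 1" "y = L2_norm (T g)" by blast
        have "B * L2_norm g \<le> \<bar>B\<bar> * 1"
          using g(2) L2_norm_nonneg[of g] by (intro mult_mono) auto
        then show "y \<le> \<bar>B\<bar>" using B[OF g(1)] g(3) by linarith
      qed
    qed
    moreover have "L2_norm (T ?h) = L2_norm (\<lambda>x. c * T f x)"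
      using T f h(1) by (intro L2_norm_cong L2_scale) (auto simp: bounded_L2_operator_def)
    ultimately have "inverse (L2_norm f) * L2_norm (T f) \<le> C"
      using C by (simp add: L2_norm_scale cn)
    then show ?thesis using pos by (simp add: field_simps)
  qed
qed

section \<open>The two bilinear estimates implied by a bound on the weighted resolvent\<close>

definition helmholtz :: "complex \<Rightarrow> R3_fun \<Rightarrow> R3_fun" where
  "helmholtz z v = (\<lambda>x. - laplacian v x - z * v x)"

definition weight :: "real \<Rightarrow> R3_fun" where
  "weight a = (\<lambda>x. of_real (japanese_bracket x powr a))"

lemma weight_add: "weight a x * weight b x = weight (a + b) x"
  by (simp add: weight_def powr_add)

lemma weight_0: "weight 0 x = 1"
proof -
  have "japanese_bracket x \<noteq> 0"
    by (metis japanese_bracket_def add_pos_nonneg less_irrefl real_sqrt_gt_zero zero_le_power2 zero_less_one)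
  then show ?thesis by (simp add: weight_def)
qed

lemma weight_cancel: "weight a x * (weight (- a) x * y) = y" "weight (- a) x * (weight a x * y) = y"
  using weight_add[of a x "- a"] by (simp_all add: weight_0 mult_ac flip: mult.assoc)

lemma test_weight: "f \<in> test_functions \<Longrightarrow> (\<lambda>x. weight a x * f x) \<in> test_functions"
  unfolding weight_def japanese_bracket_powr by (rule test_mult[OF Ck_weight])

lemma test_helmholtz: "v \<in> test_functions \<Longrightarrow> helmholtz z v \<in> test_functions"
  unfolding helmholtz_def
  using test_add[OF test_scale[of "laplacian v" "-1"] test_scale[of v "- z"]] by (simp add: test_laplacian)

text \<open>The intermediate functions of the composition are made explicit: \<open>p\<close> is the
  source passed to the resolvent, \<open>u\<close> the solution, and \<open>h\<close> stands for
  \<open>- \<Delta> u\<close>.\<close>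

lemma weighted_resolvent_iff:
  "(f, g) \<in> weighted_resolvent \<alpha> \<beta> z \<longleftrightarrow>
     (\<exists>p u h. f \<in> L2 \<and> p \<in> L2 \<and> L2_eq p (\<lambda>x. weight (- \<beta>) x * f x) \<and>
        (u, h) \<in> neg_laplacian \<and> L2_eq p (\<lambda>x. h x - z * u x) \<and>
        u \<in> L2 \<and> g \<in> L2 \<and> L2_eq g (\<lambda>x. weight (- \<alpha>) x * u x))"
  unfolding weighted_resolvent_def mult_operator_def resolvent_def shift_operator_def weight_def
  by auto

text \<open>The solution \<open>v\<close> is chosen first and the source \<open>f\<close> computed
  from it, so a pair in the graph is written down without solving an equation. Pairing its second
  component with \<open>g\<close> by Cauchy-Schwarz gives the estimate.\<close>

lemma weighted_resolvent_bound_direct: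
  assumes A: "bounded_with_norm_le (weighted_resolvent \<alpha> \<beta> z) C"
    and v: "v \<in> test_functions" and g: "g \<in> test_functions"
  shows "cmod (LINT x|lborel. weight (- \<alpha>) x * g x * v x)
     \<le> C * L2_norm g * L2_norm (\<lambda>x. weight \<beta> x * helmholtz z v x)"
proof -
  obtain T where T: "bounded_L2_operator T" "L2_operator_norm T \<le> C"
    "extends_from_test_functions T (weighted_resolvent \<alpha> \<beta> z)"
    using A unfolding bounded_with_norm_le_def by blast
  define f where "f = (\<lambda>x. weight \<beta> x * helmholtz z v x)"
  define k where "k = (\<lambda>x. weight (- \<alpha>) x * v x)"
  have tests: "f \<in> test_functions" "k \<in> test_functions" "helmholtz z v \<in> test_functions"
    "(\<lambda>x. - laplacian v x) \<in> test_functions"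
    using test_weight test_helmholtz v test_scale[OF test_laplacian[OF v], of "-1"]
    by (auto simp: f_def k_def)
  have "(f, k) \<in> weighted_resolvent \<alpha> \<beta> z"
    unfolding weighted_resolvent_iff
  proof (intro exI conjI)
    show "L2_eq (helmholtz z v) (\<lambda>x. weight (- \<beta>) x * f x)"
      by (simp add: L2_eq_def f_def weight_cancel)
    show "(v, \<lambda>x. - laplacian v x) \<in> neg_laplacian"
      using tests v by (simp add: neg_laplacian_def test_H2 test_L2 weak_laplacian_test)
    show "L2_eq (helmholtz z v) (\<lambda>x. - laplacian v x - z * v x)"
      by (simp add: L2_eq_def helmholtz_def)
    show "L2_eq k (\<lambda>x. weight (- \<alpha>) x * v x)" by (simp add: L2_eq_def k_def)
  qed (use tests v test_L2 in auto)
  then have "L2_eq (T f) k" using T(3) tests unfolding extends_from_test_functions_def by blast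
  moreover have "T f \<in> L2" using T(1) test_L2[OF tests(1)] unfolding bounded_L2_operator_def by blast
  ultimately have "L2_norm k = L2_norm (T f)" using L2_norm_cong test_L2[OF tests(2)] by metis
  also have "\<dots> \<le> C * L2_norm f" by (rule L2_norm_operator_bound[OF T(1,2) test_L2[OF tests(1)]])
  finally have k: "L2_norm k \<le> C * L2_norm f" .
  have "cmod (LINT x|lborel. g x * k x) \<le> L2_norm g * L2_norm k"
    by (intro L2_Cauchy_Schwarz test_L2 tests g)
  also have "\<dots> \<le> L2_norm g * (C * L2_norm f)"
    by (rule mult_left_mono[OF k L2_norm_nonneg])
  finally show ?thesis by (simp add: k_def f_def mult_ac)
qed

text \<open>Since \<open>g\<close> lies in the domain, some \<open>u\<close> solves the equation
  with source \<open>weight (- \<beta>) * g\<close>. Moving the operator from \<open>u\<close> onto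
  \<open>v\<close> leaves a pairing of \<open>u\<close> with \<open>helmholtz z v\<close>, into
  which the weight of exponent \<alpha> and its inverse are inserted.\<close>

lemma weighted_resolvent_bound_dual:
  assumes A: "bounded_with_norm_le (weighted_resolvent \<alpha> \<beta> z) C"
    and v: "v \<in> test_functions" and g: "g \<in> test_functions"
  shows "cmod (LINT x|lborel. weight (- \<beta>) x * g x * v x)
     \<le> C * L2_norm g * L2_norm (\<lambda>x. weight \<alpha> x * helmholtz z v x)"
proof -
  obtain T where T: "bounded_L2_operator T" "L2_operator_norm T \<le> C"
    "extends_from_test_functions T (weighted_resolvent \<alpha> \<beta> z)"
    using A unfolding bounded_with_norm_le_def by blast
  obtain k where k: "(g, k) \<in> weighted_resolvent \<alpha> \<beta> z"
    using T(3) g unfolding extends_from_test_functions_def by blast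
  obtain p u h where p: "p \<in> L2" "L2_eq p (\<lambda>x. weight (- \<beta>) x * g x)" "L2_eq p (\<lambda>x. h x - z * u x)"
    and u: "(u, h) \<in> neg_laplacian" "u \<in> L2" and kL: "k \<in> L2" "L2_eq k (\<lambda>x. weight (- \<alpha>) x * u x)"
    using k unfolding weighted_resolvent_iff by blast
  have hL: "h \<in> L2" using u by (simp add: neg_laplacian_def)
  have vL: "v \<in> L2" "laplacian v \<in> L2" using v by (simp_all add: test_L2 test_laplacian)
  define q where "q = (\<lambda>x. weight \<alpha> x * helmholtz z v x)"
  have q: "q \<in> L2" unfolding q_def by (intro test_L2 test_weight test_helmholtz v)
  have meas: "f \<in> borel_measurable lborel" if "f \<in> L2" for f using that by (simp add: L2_def)
  note [measurable] = meas[OF p(1)] meas[OF u(2)] meas[OF hL] meas[OF vL(1)] meas[OF vL(2)]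
    meas[OF kL(1)] meas[OF q] meas[OF test_L2[OF g]] test_measurable[OF test_weight[OF g]]
    test_measurable[OF test_helmholtz[OF v]]
  \<comment> \<open>The weak equation for \<open>u\<close> is tested with \<open>v\<close>
    itself.\<close>
  have lap: "(LINT x|lborel. u x * laplacian v x) = - (LINT x|lborel. h x * v x)"
    using u(1) v by (auto simp: neg_laplacian_def weak_laplacian_def laplacian_def)
  have "(LINT x|lborel. weight (- \<beta>) x * g x * v x) = (LINT x|lborel. (h x - z * u x) * v x)"
    using p(2,3) by (intro integral_cong_AE) (auto simp: L2_eq_def)
  also have "\<dots> = (LINT x|lborel. h x * v x) - z * (LINT x|lborel. u x * v x)"
    by (simp add: left_diff_distrib mult.assoc L2_mult_integrable hL vL u)
  also have "\<dots> = (LINT x|lborel. u x * helmholtz z v x)"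
    using lap
    by (simp add: helmholtz_def right_diff_distrib mult.left_commute[of _ z] L2_mult_integrable vL u)
  \<comment> \<open>Here the cancelling weights enter: \<open>k\<close> is
    \<open>weight (- \<alpha>) * u\<close> almost everywhere and \<open>q\<close> carries the
    opposite weight.\<close>
  also have "\<dots> = (LINT x|lborel. k x * q x)"
  proof (rule integral_cong_AE)
    show "AE x in lborel. u x * helmholtz z v x = k x * q x"
      using kL(2) unfolding L2_eq_def
    proof eventually_elim
      case (elim x)
      have "k x * q x = weight (- \<alpha>) x * (weight \<alpha> x * (u x * helmholtz z v x))"
        by (simp add: elim q_def mult_ac)
      then show ?case by (simp add: weight_cancel)
    qed
  qed measurable
  finally have "cmod (LINT x|lborel. weight (- \<beta>) x * g x * v x) \<le> L2_norm k * L2_norm q"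
    using L2_Cauchy_Schwarz[OF kL(1) q] by simp
  moreover have "L2_norm k \<le> C * L2_norm g"
  proof -
    have "L2_eq (T g) k" using T(3) g k unfolding extends_from_test_functions_def by blast
    moreover have "T g \<in> L2" using T(1) test_L2[OF g] unfolding bounded_L2_operator_def by blast
    ultimately have "L2_norm k = L2_norm (T g)" using L2_norm_cong kL(1) by metis
    also have "\<dots> \<le> C * L2_norm g" by (rule L2_norm_operator_bound[OF T(1,2) test_L2[OF g]])
    finally show ?thesis .
  qed
  ultimately have "cmod (LINT x|lborel. weight (- \<beta>) x * g x * v x) \<le> C * L2_norm g * L2_norm q"
    using mult_right_mono[OF _ L2_norm_nonneg[of q], of "L2_norm k" "C * L2_norm g"] by linarith
  then show ?thesis by (simp add: q_def)
qed

section \<open>Radial test functions\<close>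

definition radial_integral :: "(real \<Rightarrow> real) \<Rightarrow> real" where
  "radial_integral H = (LINT x|lborel. H ((x :: real ^ 3) \<bullet> x))"

lemma radial_integrable:
  fixes H :: "real \<Rightarrow> real"
  assumes "continuous_on {0..} H" "\<And>s. s > M \<Longrightarrow> H s = 0"
  shows "integrable lborel (\<lambda>x :: real ^ 3. H (x \<bullet> x))"
proof (rule integrable_compact_support)
  show "continuous_on UNIV (\<lambda>x :: real ^ 3. H (x \<bullet> x))"
    by (rule continuous_on_compose2[OF assms(1)]) (auto intro!: continuous_intros)
  fix x :: "real ^ 3" assume "norm x > sqrt \<bar>M\<bar>"
  then have "(sqrt \<bar>M\<bar>)\<^sup>2 < (norm x)\<^sup>2" by (intro power_strict_mono) auto
  then have "x \<bullet> x > M" by (simp add: power2_norm_eq_inner)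
  then show "H (x \<bullet> x) = 0" by (rule assms(2))
qed

lemma radial_integral_nonneg: "(\<And>s. s \<ge> 0 \<Longrightarrow> H s \<ge> 0) \<Longrightarrow> radial_integral H \<ge> 0"
  unfolding radial_integral_def by (intro Bochner_Integration.integral_nonneg) simp

text \<open>Comparison with \<open>K\<close> times the indicator of the ball of radius
  \<open>M\<close>. The profile is a function of \<open>|x|^2\<close>, so radii enter its hypotheses
  squared.\<close>

lemma radial_integral_le:
  assumes "continuous_on {0..} H" "\<And>s. s > M\<^sup>2 \<Longrightarrow> H s = 0" "\<And>s. s \<ge> 0 \<Longrightarrow> s \<le> M\<^sup>2 \<Longrightarrow> H s \<le> K"
    "M \<ge> 0"
  shows "radial_integral H \<le> K * unit_ball_vol 3 * M ^ 3"
proof -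
  have "radial_integral H \<le> (LINT x|lborel. indicator (cball (0 :: real ^ 3) M) x *\<^sub>R K)"
    unfolding radial_integral_def
  proof (rule integral_mono)
    show "integrable lborel (\<lambda>x :: real ^ 3. H (x \<bullet> x))"
      using assms(1,2) by (rule radial_integrable)
    show "integrable lborel (\<lambda>x::real^3. indicator (cball 0 M) x *\<^sub>R K)"
      by (rule borel_integrable_compact) auto
    show "H (x \<bullet> x) \<le> indicator (cball 0 M) x *\<^sub>R K" for x :: "real ^ 3"
    proof (cases "norm x \<le> M")
      case True
      then have "(norm x)\<^sup>2 \<le> M\<^sup>2" by (intro power_mono) auto
      then show ?thesis using assms(3) True by (simp add: power2_norm_eq_inner)
    next
      case False
      then have "M\<^sup>2 < (norm x)\<^sup>2" using assms(4) by (intro power_strict_mono) auto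
      then show ?thesis using assms(2) False by (simp add: power2_norm_eq_inner)
    qed
  qed
  also have "\<dots> = K * unit_ball_vol 3 * M ^ 3"
    using content_cball[OF assms(4), of "0 :: real ^ 3"] by (simp add: mult_ac)
  finally show ?thesis .
qed

text \<open>The minorant is \<open>k\<close> on the shell between radii \<open>m\<close> and
  \<open>M\<close> and \<open>0\<close> elsewhere, written as a difference of two ball indicators so
  that only volumes of balls are required.\<close>

lemma radial_integral_ge:
  assumes "continuous_on {0..} H" "\<And>s. s > A \<Longrightarrow> H s = 0" "\<And>s. s \<ge> 0 \<Longrightarrow> H s \<ge> 0"
    "\<And>s. m\<^sup>2 \<le> s \<Longrightarrow> s \<le> M\<^sup>2 \<Longrightarrow> H s \<ge> k" "0 \<le> m" "m \<le> M" "k \<ge> 0"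
  shows "radial_integral H \<ge> k * unit_ball_vol 3 * (M ^ 3 - m ^ 3)"
proof -
  have int: "integrable lborel (\<lambda>x::real^3. indicator (cball 0 M) x *\<^sub>R k - indicator (cball 0 m) x *\<^sub>R k)"
    by (intro Bochner_Integration.integrable_diff borel_integrable_compact) auto
  have "k * unit_ball_vol 3 * (M ^ 3 - m ^ 3)
      = (LINT x|lborel. indicator (cball (0 :: real ^ 3) M) x *\<^sub>R k) - (LINT x|lborel. indicator (cball (0 :: real ^ 3) m) x *\<^sub>R k)"
    using content_cball[of m "0 :: real ^ 3"] content_cball[of M "0 :: real ^ 3"] assms(5,6)
    by (simp add: right_diff_distrib mult_ac)
  also have "\<dots> = (LINT x|lborel. indicator (cball 0 M) x *\<^sub>R k - indicator (cball (0 :: real ^ 3) m) x *\<^sub>R k)"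
    by (intro Bochner_Integration.integral_diff[symmetric] borel_integrable_compact) auto
  also have "\<dots> \<le> radial_integral H"
    unfolding radial_integral_def
  proof (rule integral_mono[OF int])
    show "integrable lborel (\<lambda>x :: real ^ 3. H (x \<bullet> x))"
      using assms(1,2) by (rule radial_integrable)
    fix x :: "real ^ 3"
    have pos: "H (x \<bullet> x) \<ge> 0" by (simp add: assms(3))
    show "indicator (cball 0 M) x *\<^sub>R k - indicator (cball 0 m) x *\<^sub>R k \<le> H (x \<bullet> x)"
    proof (cases "norm x \<le> M \<and> norm x > m")
      case True
      then have "(norm x)\<^sup>2 \<le> M\<^sup>2" "m\<^sup>2 \<le> (norm x)\<^sup>2" using assms(5) by (auto intro!: power_mono)
      then show ?thesis using assms(4) True by (simp add: power2_norm_eq_inner)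
    next
      case False
      then show ?thesis using pos assms(6,7) by (auto simp: indicator_def)
    qed
  qed
  finally show ?thesis .
qed

lemma unit_ball_vol_3_pos: "unit_ball_vol 3 > 0"
  using unit_ball_vol_pos[of 3] by simp

text \<open>This is \<open>\<Delta> + \<kappa>\<close> on radial functions, with the sign opposite
  to \<open>helmholtz\<close>; the sign disappears in the squared norms.\<close>

definition radial_helmholtz :: "real \<Rightarrow> (real \<Rightarrow> real) \<Rightarrow> real \<Rightarrow> real" where
  "radial_helmholtz \<kappa> F s = 4 * s * deriv (deriv F) s + 6 * deriv F s + \<kappa> * F s"

lemma radial_helmholtz_continuous:
  assumes "smooth F" shows "continuous_on S (radial_helmholtz \<kappa> F)"
  unfolding radial_helmholtz_def[abs_def]
  by (intro continuous_intros smooth_continuous smooth_deriv(2) assms)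

lemma radial_helmholtz_zero:
  assumes "smooth F" "\<And>s. s > M \<Longrightarrow> F s = 0" "s > M"
  shows "radial_helmholtz \<kappa> F s = 0"
proof -
  have z: "deriv f s = 0" if "smooth f" "\<And>s. s > M \<Longrightarrow> f s = 0" "s > M" for f s
  proof -
    have "((\<lambda>s. 0) has_real_derivative 0) (at s)" by simp
    then have "(f has_real_derivative 0) (at s)"
      by (rule DERIV_cong_ev[THEN iffD1, rotated -1])
        (use that in \<open>auto simp: eventually_nhds intro!: exI[of _ "{M<..}"]\<close>)
    then show ?thesis by (rule DERIV_imp_deriv)
  qed
  have "deriv F s = 0" if "s > M" for s using z assms(1,2) that by blast
  moreover from this have "deriv (deriv F) s = 0" if "s > M" for s
    using z smooth_deriv(2)[OF assms(1)] that by blast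
  ultimately show ?thesis using assms by (simp add: radial_helmholtz_def)
qed

definition bilinear_bound :: "real \<Rightarrow> real \<Rightarrow> real \<Rightarrow> bool" where
  "bilinear_bound a b C \<longleftrightarrow> (\<forall>z g v. z \<notin> \<real> \<longrightarrow> cmod z < 1 \<longrightarrow> g \<in> test_functions \<longrightarrow> v \<in> test_functions \<longrightarrow>
     cmod (LINT x|lborel. weight (- a) x * g x * v x)
       \<le> C * L2_norm g * L2_norm (\<lambda>x. weight b x * helmholtz z v x))"

lemma test_radial:
  assumes "smooth F" "\<And>s. s > M \<Longrightarrow> F s = 0"
  shows "(\<lambda>x. complex_of_real (F (x \<bullet> x))) \<in> test_functions"
proof (rule test_functionsI)
  show "Ck k (\<lambda>x. complex_of_real (F (x \<bullet> x)))" for k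
    using assms(1) by (intro Ck_radial) (simp add: smooth_def del: ndiff.simps)
  fix x :: "real ^ 3" assume "norm x > sqrt \<bar>M\<bar>"
  then have "(sqrt \<bar>M\<bar>)\<^sup>2 < (norm x)\<^sup>2" by (intro power_strict_mono) auto
  then have "x \<bullet> x > M" by (simp add: power2_norm_eq_inner)
  then show "complex_of_real (F (x \<bullet> x)) = 0" by (simp add: assms(2))
qed

text \<open>Letting \<open>z\<close> tend to the real energy \<open>\<kappa>\<close> from above: for real \<open>v\<close> the squared norm of
  \<open>(- \<Delta> - z) v\<close> is an exact quadratic polynomial in the imaginary part of \<open>z\<close>.\<close>

lemma bilinear_bound_radial:
  assumes B: "bilinear_bound a b C" and \<kappa>: "0 \<le> \<kappa>" "\<kappa> < 1"
    and F: "smooth F" "\<And>s. s > M \<Longrightarrow> F s = 0" and G: "smooth G" "\<And>s. s > M \<Longrightarrow> G s = 0"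
  shows "\<bar>radial_integral (\<lambda>s. (1 + s) powr (- a / 2) * (G s * F s))\<bar>
    \<le> C * sqrt (radial_integral (\<lambda>s. (G s)\<^sup>2))
        * sqrt (radial_integral (\<lambda>s. (1 + s) powr b * (radial_helmholtz \<kappa> F s)\<^sup>2))"
proof -
  let ?v = "\<lambda>x. complex_of_real (F (x \<bullet> x))" and ?g = "\<lambda>x. complex_of_real (G (x \<bullet> x))"
  let ?P = "radial_integral (\<lambda>s. (1 + s) powr b * (radial_helmholtz \<kappa> F s)\<^sup>2)"
  let ?Q = "radial_integral (\<lambda>s. (1 + s) powr b * (F s)\<^sup>2)"
  have lap: "laplacian ?v = (\<lambda>x. of_real (radial_helmholtz \<kappa> F (x \<bullet> x) - \<kappa> * F (x \<bullet> x)))"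
    by (subst laplacian_radial[OF smooth_deriv(1)[OF F(1)] smooth_deriv(1)[OF smooth_deriv(2)[OF F(1)]]])
      (simp add: radial_helmholtz_def)
  have cont: "continuous_on {0..} (\<lambda>s::real. (1 + s) powr b)"
    by (intro continuous_intros) auto
  have norm2: "(LINT x|lborel. (cmod (weight b x * helmholtz (Complex \<kappa> \<epsilon>) ?v x))\<^sup>2) = ?P + \<epsilon>\<^sup>2 * ?Q" for \<epsilon>
  proof -
    have "(cmod (weight b x * helmholtz (Complex \<kappa> \<epsilon>) ?v x))\<^sup>2
        = (1 + x \<bullet> x) powr b * (radial_helmholtz \<kappa> F (x \<bullet> x))\<^sup>2 + \<epsilon>\<^sup>2 * ((1 + x \<bullet> x) powr b * (F (x \<bullet> x))\<^sup>2)" for x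
    proof -
      have "helmholtz (Complex \<kappa> \<epsilon>) ?v x = Complex (- radial_helmholtz \<kappa> F (x \<bullet> x)) (- \<epsilon> * F (x \<bullet> x))"
        by (simp add: helmholtz_def lap complex_eq_iff)
      then have h: "(cmod (helmholtz (Complex \<kappa> \<epsilon>) ?v x))\<^sup>2 = (radial_helmholtz \<kappa> F (x \<bullet> x))\<^sup>2 + \<epsilon>\<^sup>2 * (F (x \<bullet> x))\<^sup>2"
        by (simp add: cmod_power2 power_mult_distrib)
      have "((1 + x \<bullet> x) powr (b / 2))\<^sup>2 = (1 + x \<bullet> x) powr b"
        by (simp add: power2_eq_square powr_add[symmetric])
      then have "(cmod (weight b x))\<^sup>2 = (1 + x \<bullet> x) powr b"
        by (simp add: weight_def japanese_bracket_powr)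
      then show ?thesis by (simp add: norm_mult power_mult_distrib h algebra_simps)
    qed
    moreover have "integrable lborel (\<lambda>x :: real ^ 3. (1 + x \<bullet> x) powr b * (radial_helmholtz \<kappa> F (x \<bullet> x))\<^sup>2)"
      by (rule radial_integrable[where M = M])
        (auto intro!: continuous_intros cont radial_helmholtz_continuous F simp: radial_helmholtz_zero[OF F])
    moreover have "integrable lborel (\<lambda>x :: real ^ 3. (1 + x \<bullet> x) powr b * (F (x \<bullet> x))\<^sup>2)"
      by (rule radial_integrable[where M = M])
        (auto intro!: continuous_on_mult cont continuous_on_power smooth_continuous[OF F(1)] simp: F(2))
    ultimately show ?thesis by (simp add: radial_integral_def)
  qed
  have Gn: "L2_norm ?g = sqrt (radial_integral (\<lambda>s. (G s)\<^sup>2))"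
    by (simp add: L2_norm_def radial_integral_def)
  have lhs: "cmod (LINT x|lborel. weight (- a) x * ?g x * ?v x)
      = \<bar>radial_integral (\<lambda>s. (1 + s) powr (- a / 2) * (G s * F s))\<bar>"
  proof -
    have "(\<lambda>x. weight (- a) x * ?g x * ?v x)
        = (\<lambda>x. complex_of_real ((1 + x \<bullet> x) powr (- a / 2) * (G (x \<bullet> x) * F (x \<bullet> x))))"
      by (simp add: weight_def japanese_bracket_powr fun_eq_iff)
    then show ?thesis
      by (simp only: radial_integral_def integral_complex_of_real norm_of_real real_norm_def)
  qed
  let ?X = "\<bar>radial_integral (\<lambda>s. (1 + s) powr (- a / 2) * (G s * F s))\<bar>"
  let ?c = "C * sqrt (radial_integral (\<lambda>s. (G s)\<^sup>2))"
  \<comment> \<open>The modulus of \<open>Complex \<kappa> \<epsilon>\<close> is at most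
    \<open>\<kappa> + \<epsilon>\<close>, so the restriction on \<epsilon> keeps it below
    \<open>1\<close>, and \<open>\<epsilon> > 0\<close> keeps it off the real axis.\<close>
  have ev: "?X \<le> ?c * sqrt (?P + \<epsilon>\<^sup>2 * ?Q)" if \<epsilon>: "0 < \<epsilon>" "\<epsilon> < 1 - \<kappa>" for \<epsilon>
  proof -
    have "Complex \<kappa> \<epsilon> \<notin> \<real>" using \<epsilon> by (simp add: complex_is_Real_iff)
    moreover have "cmod (Complex \<kappa> \<epsilon>) < 1" using cmod_le[of "Complex \<kappa> \<epsilon>"] \<kappa> \<epsilon> by simp
    ultimately have "?X \<le> ?c * L2_norm (\<lambda>x. weight b x * helmholtz (Complex \<kappa> \<epsilon>) ?v x)"
      using B test_radial[OF F] test_radial[OF G] unfolding bilinear_bound_def lhs[symmetric] Gn[symmetric]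
      by blast
    then show ?thesis by (simp only: L2_norm_def norm2)
  qed
  have "((\<lambda>\<epsilon>. ?c * sqrt (?P + \<epsilon>\<^sup>2 * ?Q)) \<longlongrightarrow> ?c * sqrt (?P + 0\<^sup>2 * ?Q)) (at_right 0)"
    by (intro tendsto_intros)
  moreover have "\<forall>\<^sub>F \<epsilon> in at_right 0. ?X \<le> ?c * sqrt (?P + \<epsilon>\<^sup>2 * ?Q)"
    using ev eventually_at_right_real[of 0 "1 - \<kappa>"] \<kappa> by (auto elim!: eventually_mono)
  ultimately show ?thesis
    using tendsto_lowerbound[of _ _ "at_right (0::real)" ?X] by fastforce
qed

section \<open>Cut-off spherical waves\<close>

text \<open>The cutoff falls off between \<open>|x| = R\<close> and \<open>|x| = sqrt 2 * R\<close>.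
  At \<open>\<kappa> = 0\<close> the wave factor is \<open>1\<close>, so the same family contains
  the plain cutoffs used for the scaling argument.\<close>

definition cutoff_wave :: "real \<Rightarrow> real \<Rightarrow> real \<Rightarrow> real" where
  "cutoff_wave \<kappa> R s = cutoff (s / R\<^sup>2) * sinc_sqrt (\<kappa> * s)"

lemma smooth_dilation: "smooth f \<Longrightarrow> smooth (\<lambda>s. f (c * s))"
  by (rule smooth_compose[OF _ smooth_mult[OF smooth_const smooth_id]])

lemma deriv_dilation:
  assumes "smooth f" shows "deriv (\<lambda>s. f (c * s)) = (\<lambda>s. c * deriv f (c * s))"
proof
  fix s
  have "((\<lambda>s. c * s) has_real_derivative c) (at s)" by (auto intro!: derivative_eq_intros)
  from DERIV_chain2[OF smooth_deriv(1)[OF assms] this]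
  show "deriv (\<lambda>s. f (c * s)) s = c * deriv f (c * s)"
    by (simp add: DERIV_imp_deriv mult.commute)
qed

lemma deriv_mult_smooth:
  assumes "smooth f" "smooth g"
  shows "deriv (\<lambda>s. f s * g s) = (\<lambda>s. deriv f s * g s + deriv g s * f s)"
  by (intro ext DERIV_imp_deriv DERIV_mult smooth_deriv(1) assms)

lemma smooth_cutoff_wave: "smooth (cutoff_wave \<kappa> R)"
proof -
  have "smooth (\<lambda>s. cutoff (inverse (R\<^sup>2) * s) * sinc_sqrt (\<kappa> * s))"
    by (rule smooth_mult[OF smooth_dilation[OF smooth_cutoff] smooth_dilation[OF smooth_sinc_sqrt]])
  then show ?thesis by (simp add: cutoff_wave_def[abs_def] divide_inverse mult.commute)
qed

lemma cutoff_wave_zero: "R > 0 \<Longrightarrow> s \<ge> 2 * R\<^sup>2 \<Longrightarrow> cutoff_wave \<kappa> R s = 0"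
  by (simp add: cutoff_wave_def cutoff_eq_0 pos_le_divide_eq)

lemma cutoff_wave_top: "R > 0 \<Longrightarrow> s \<le> R\<^sup>2 \<Longrightarrow> cutoff_wave \<kappa> R s = cutoff_top * sinc_sqrt (\<kappa> * s)"
  by (simp add: cutoff_wave_def cutoff_eq_top pos_divide_le_eq)

text \<open>Only terms with a derivative on the cutoff survive, because \<open>sinc_sqrt (\<kappa> * s)\<close> solves the
  Helmholtz equation at energy \<open>\<kappa>\<close>.\<close>

lemma radial_helmholtz_cutoff_wave:
  "radial_helmholtz \<kappa> (cutoff_wave \<kappa> R) s
     = (4 * (s / R\<^sup>2) * deriv (deriv cutoff) (s / R\<^sup>2) * sinc_sqrt (\<kappa> * s)
        + 8 * deriv cutoff (s / R\<^sup>2) * (\<kappa> * s * deriv sinc_sqrt (\<kappa> * s))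
        + 6 * deriv cutoff (s / R\<^sup>2) * sinc_sqrt (\<kappa> * s)) / R\<^sup>2"
proof -
  define c where "c = inverse (R\<^sup>2)"
  have c: "s / R\<^sup>2 = c * s" for s by (simp add: c_def divide_inverse mult.commute)
  note sm = smooth_cutoff smooth_deriv(2)[OF smooth_cutoff] smooth_sinc_sqrt smooth_deriv(2)[OF smooth_sinc_sqrt]
  note sms = smooth_dilation[OF sm(1), of c] smooth_dilation[OF sm(2), of c]
    smooth_dilation[OF sm(3), of \<kappa>] smooth_dilation[OF sm(4), of \<kappa>]
  let ?w = "\<lambda>s. sinc_sqrt (\<kappa> * s)"
  have F: "cutoff_wave \<kappa> R = (\<lambda>s. cutoff (c * s) * ?w s)" by (simp add: cutoff_wave_def fun_eq_iff c)
  have F1: "deriv (cutoff_wave \<kappa> R)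
      = (\<lambda>s. c * deriv cutoff (c * s) * ?w s + \<kappa> * deriv sinc_sqrt (\<kappa> * s) * cutoff (c * s))"
    unfolding F by (simp add: deriv_mult_smooth sms deriv_dilation sm)
  have F2: "deriv (deriv (cutoff_wave \<kappa> R))
      = (\<lambda>s. c * c * deriv (deriv cutoff) (c * s) * ?w s + 2 * c * \<kappa> * deriv cutoff (c * s) * deriv sinc_sqrt (\<kappa> * s)
           + \<kappa> * \<kappa> * deriv (deriv sinc_sqrt) (\<kappa> * s) * cutoff (c * s))"
  proof
    fix s
    note d = smooth_deriv(1)[OF sms(1), of s] smooth_deriv(1)[OF sms(2), of s]
      smooth_deriv(1)[OF sms(3), of s] smooth_deriv(1)[OF sms(4), of s]
    show "deriv (deriv (cutoff_wave \<kappa> R)) s =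
           c * c * deriv (deriv cutoff) (c * s) * ?w s + 2 * c * \<kappa> * deriv cutoff (c * s) * deriv sinc_sqrt (\<kappa> * s)
           + \<kappa> * \<kappa> * deriv (deriv sinc_sqrt) (\<kappa> * s) * cutoff (c * s)"
      unfolding F1
      by (rule DERIV_imp_deriv,
          rule DERIV_cong[OF DERIV_add[OF DERIV_mult[OF DERIV_cmult[OF d(2)] d(3)]
              DERIV_mult[OF DERIV_cmult[OF d(4)] d(1)]]])
        (simp only: deriv_dilation sm, simp add: algebra_simps)
  qed
  have "radial_helmholtz \<kappa> (cutoff_wave \<kappa> R) s
      = c * (4 * (c * s) * deriv (deriv cutoff) (c * s) * ?w s
          + 8 * deriv cutoff (c * s) * (\<kappa> * s * deriv sinc_sqrt (\<kappa> * s)) + 6 * deriv cutoff (c * s) * ?w s)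
        + \<kappa> * cutoff (c * s) * (4 * (\<kappa> * s) * deriv (deriv sinc_sqrt) (\<kappa> * s)
          + 6 * deriv sinc_sqrt (\<kappa> * s) + sinc_sqrt (\<kappa> * s))"
    unfolding radial_helmholtz_def F2 unfolding F1 unfolding F by (simp add: algebra_simps)
  then show ?thesis unfolding sinc_sqrt_ode c by (simp add: c_def divide_inverse mult.commute)
qed

text \<open>On the transition shell \<open>s / R^2\<close> is at most \<open>2\<close>, the cutoff
  derivatives are bounded by \<open>M\<close>, and both wave factors are bounded by \<open>1\<close>
  whatever the energy. Hence \<open>K\<close> depends neither on \<kappa> nor on
  \<open>R\<close>.\<close>

lemma radial_helmholtz_cutoff_wave_bound:
  obtains K where "K \<ge> 0"
    "\<And>\<kappa> R s. R > 0 \<Longrightarrow> \<kappa> \<ge> 0 \<Longrightarrow> s \<ge> 0 \<Longrightarrow> \<bar>radial_helmholtz \<kappa> (cutoff_wave \<kappa> R) s\<bar> \<le> K / R\<^sup>2"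
    "\<And>\<kappa> R s. R > 0 \<Longrightarrow> s \<notin> {R\<^sup>2..2 * R\<^sup>2} \<Longrightarrow> radial_helmholtz \<kappa> (cutoff_wave \<kappa> R) s = 0"
proof -
  obtain M where M: "M \<ge> 0" "\<And>s. \<bar>deriv cutoff s\<bar> \<le> M" "\<And>s. \<bar>deriv (deriv cutoff) s\<bar> \<le> M"
    "\<And>s. s \<notin> {1..2} \<Longrightarrow> deriv cutoff s = 0" "\<And>s. s \<notin> {1..2} \<Longrightarrow> deriv (deriv cutoff) s = 0"
    by (rule cutoff_derivatives) blast
  have zero: "radial_helmholtz \<kappa> (cutoff_wave \<kappa> R) s = 0" if "R > 0" "s \<notin> {R\<^sup>2..2 * R\<^sup>2}" for \<kappa> R s
  proof -
    have "s / R\<^sup>2 \<notin> {1..2}" using that by (auto simp: pos_le_divide_eq pos_divide_le_eq)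
    then show ?thesis by (simp add: radial_helmholtz_cutoff_wave M(4,5))
  qed
  \<comment> \<open>The three terms contribute \<open>4 * 2\<close>, \<open>8\<close> and
    \<open>6\<close> multiples of \<open>M\<close>, in all \<open>22\<close>.\<close>
  have "\<bar>radial_helmholtz \<kappa> (cutoff_wave \<kappa> R) s\<bar> \<le> 22 * M / R\<^sup>2" if "R > 0" "\<kappa> \<ge> 0" "s \<ge> 0" for \<kappa> R s
  proof (cases "s \<in> {R\<^sup>2..2 * R\<^sup>2}")
    case True
    let ?t = "s / R\<^sup>2" and ?w = "sinc_sqrt (\<kappa> * s)" and ?w' = "\<kappa> * s * deriv sinc_sqrt (\<kappa> * s)"
    have t: "\<bar>?t\<bar> \<le> 2" using True that by (auto simp: pos_divide_le_eq)
    have w: "\<bar>?w\<bar> \<le> 1" "\<bar>?w'\<bar> \<le> 1"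
      using that sinc_sqrt_bound[of "\<kappa> * s"] sinc_sqrt_deriv_bound[of "\<kappa> * s"] by auto
    have "\<bar>?t\<bar> * \<bar>deriv (deriv cutoff) ?t\<bar> * \<bar>?w\<bar> \<le> 2 * M * 1"
      by (intro mult_mono t w M; simp add: M(1))
    then have 1: "\<bar>4 * ?t * deriv (deriv cutoff) ?t * ?w\<bar> \<le> 8 * M" by (simp add: abs_mult)
    have "\<bar>deriv cutoff ?t\<bar> * \<bar>?w'\<bar> \<le> M * 1" by (intro mult_mono w M) (auto simp: M(1))
    then have 2: "\<bar>8 * deriv cutoff ?t * ?w'\<bar> \<le> 8 * M" by (simp add: abs_mult)
    have "\<bar>deriv cutoff ?t\<bar> * \<bar>?w\<bar> \<le> M * 1" by (intro mult_mono w M) (auto simp: M(1))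
    then have 3: "\<bar>6 * deriv cutoff ?t * ?w\<bar> \<le> 6 * M" by (simp add: abs_mult)
    have "\<bar>4 * ?t * deriv (deriv cutoff) ?t * ?w + 8 * deriv cutoff ?t * ?w' + 6 * deriv cutoff ?t * ?w\<bar> \<le> 22 * M"
      using order_trans[OF abs_triangle_ineq add_mono[OF order_trans[OF abs_triangle_ineq add_mono[OF 1 2]] 3]]
      by simp
    then show ?thesis
      unfolding radial_helmholtz_cutoff_wave abs_divide by (simp add: divide_right_mono)
  next
    case False
    then show ?thesis using zero[of R s] that M(1) by simp
  qed
  then show ?thesis using that[of "22 * M"] M(1) zero by simp
qed

text \<open>Power counting on the shell \<open>|x| ~ R\<close>: the weight gives
  \<open>2 * b\<close>, the squared Helmholtz term \<open>- 4\<close> and the volume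
  \<open>3\<close>.\<close>

lemma cutoff_wave_energy:
  obtains K where "K \<ge> 0"
    "\<And>\<kappa> R. R \<ge> 1 \<Longrightarrow> \<kappa> \<ge> 0 \<Longrightarrow>
       radial_integral (\<lambda>s. (1 + s) powr b * (radial_helmholtz \<kappa> (cutoff_wave \<kappa> R) s)\<^sup>2) \<le> K * R powr (2 * b - 1)"
proof -
  obtain K where K: "K \<ge> 0"
    "\<And>\<kappa> R s. R > 0 \<Longrightarrow> \<kappa> \<ge> 0 \<Longrightarrow> s \<ge> 0 \<Longrightarrow> \<bar>radial_helmholtz \<kappa> (cutoff_wave \<kappa> R) s\<bar> \<le> K / R\<^sup>2"
    "\<And>\<kappa> R s. R > 0 \<Longrightarrow> s \<notin> {R\<^sup>2..2 * R\<^sup>2} \<Longrightarrow> radial_helmholtz \<kappa> (cutoff_wave \<kappa> R) s = 0"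
    by (rule radial_helmholtz_cutoff_wave_bound) blast
  \<comment> \<open>On the shell the ratio \<open>(1 + s) / R^2\<close> lies in
    \<open>[1, 3]\<close>, because \<open>R \<ge> 1\<close>; the maximum over the endpoints covers
    both signs of \<open>b\<close>.\<close>
  define B where "B = max 1 (3 powr b)"
  have B: "B \<ge> 0" by (simp add: B_def)
  show ?thesis
  proof (rule that[of "B * K\<^sup>2 * unit_ball_vol 3 * sqrt 2 ^ 3"])
    show "0 \<le> B * K\<^sup>2 * unit_ball_vol 3 * sqrt 2 ^ 3"
      using B unit_ball_vol_3_pos by simp
    fix \<kappa> R :: real assume R: "R \<ge> 1" and \<kappa>: "\<kappa> \<ge> 0"
    let ?H = "\<lambda>s. (1 + s) powr b * (radial_helmholtz \<kappa> (cutoff_wave \<kappa> R) s)\<^sup>2"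
    have M2: "(sqrt 2 * R)\<^sup>2 = 2 * R\<^sup>2" by (simp add: power_mult_distrib)
    have "radial_integral ?H \<le> (B * R powr (2 * b) * (K / R\<^sup>2)\<^sup>2) * unit_ball_vol 3 * (sqrt 2 * R) ^ 3"
    proof (rule radial_integral_le)
      show "continuous_on {0..} ?H"
        by (intro continuous_intros radial_helmholtz_continuous smooth_cutoff_wave) auto
      show "?H s = 0" if "s > (sqrt 2 * R)\<^sup>2" for s
        using that R K(3)[of R s] unfolding M2 by simp
      fix s assume s: "s \<ge> 0" "s \<le> (sqrt 2 * R)\<^sup>2"
      show "?H s \<le> B * R powr (2 * b) * (K / R\<^sup>2)\<^sup>2"
      proof (cases "s \<in> {R\<^sup>2..2 * R\<^sup>2}")
        case True
        define q where "q = (1 + s) / R\<^sup>2"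
        have R2: "R\<^sup>2 \<ge> 1" using R by simp
        have "R\<^sup>2 \<le> 1 + s" "1 + s \<le> 3 * R\<^sup>2"
          using True R2 unfolding atLeastAtMost_iff by linarith+
        then have q: "1 \<le> q" "q \<le> 3"
          using R by (auto simp: q_def pos_le_divide_eq pos_divide_le_eq)
        have "q powr b \<le> B"
        proof (cases "b \<ge> 0")
          case True
          then have "q powr b \<le> 3 powr b" using q by (intro powr_mono2) auto
          then show ?thesis by (simp add: B_def)
        next
          case False
          then have "q powr b \<le> 1 powr b" using q by (intro powr_mono2') auto
          then show ?thesis by (simp add: B_def)
        qed
        moreover have "(1 + s) powr b = q powr b * R powr (2 * b)"
        proof -
          have "1 + s = q * R powr 2" using R by (simp add: q_def powr_numeral)
          then have "(1 + s) powr b = (q * R powr 2) powr b" by simp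
          also have "\<dots> = q powr b * R powr (2 * b)" using q by (simp add: powr_mult powr_powr)
          finally show ?thesis .
        qed
        ultimately have "(1 + s) powr b \<le> B * R powr (2 * b)" by (simp add: mult_right_mono)
        moreover have "(radial_helmholtz \<kappa> (cutoff_wave \<kappa> R) s)\<^sup>2 \<le> (K / R\<^sup>2)\<^sup>2"
          using K(2)[of R \<kappa> s] R \<kappa> s by (simp add: abs_le_square_iff[symmetric] K(1))
        ultimately show ?thesis using B by (intro mult_mono) auto
      next
        case False
        then show ?thesis using K(3)[of R s] R B by simp
      qed
    qed (use R in simp)
    also have "\<dots> = B * K\<^sup>2 * unit_ball_vol 3 * sqrt 2 ^ 3 * R powr (2 * b - 1)"
    proof -
      have "R powr (2 * b - 1) = R powr (2 * b) / R" using R by (simp add: powr_diff)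
      then show ?thesis using R by (simp add: field_simps power2_eq_square power3_eq_cube)
    qed
    finally show "radial_integral ?H \<le> B * K\<^sup>2 * unit_ball_vol 3 * sqrt 2 ^ 3 * R powr (2 * b - 1)" .
  qed
qed

text \<open>With \<open>g = v\<close> a cutoff at radius \<open>R\<close> and energy zero, the
  pairing is at least of order \<open>R^(3 - a)\<close>, while the two norms are at most of orders
  \<open>R^(3/2)\<close> and \<open>R^(b - 1/2)\<close>. Letting \<open>R\<close> grow contradicts
  \<open>a + b < 2\<close>.\<close>

lemma bilinear_bound_scaling:
  assumes "bilinear_bound a b C" shows "a + b \<ge> 2"
proof (rule ccontr)
  assume "\<not> a + b \<ge> 2"
  then have ab: "2 - a - b > 0" by simp
  obtain K where K: "K \<ge> 0" "\<And>\<kappa> R. R \<ge> 1 \<Longrightarrow> \<kappa> \<ge> 0 \<Longrightarrow>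
       radial_integral (\<lambda>s. (1 + s) powr b * (radial_helmholtz \<kappa> (cutoff_wave \<kappa> R) s)\<^sup>2) \<le> K * R powr (2 * b - 1)"
    by (rule cutoff_wave_energy[of b]) blast
  let ?V = "unit_ball_vol 3"
  \<comment> \<open>A lower bound for \<open>q powr (- a / 2)\<close> when
    \<open>q = (1 + s) / R^2\<close> lies in \<open>[1/4, 2]\<close>, which is its range on the
    shell \<open>R / 2 \<le> |x| \<le> R\<close>; which endpoint is decisive depends on the sign of
    \<open>a\<close>.\<close>
  define k where "k = min ((1 / 4) powr (- a / 2)) (2 powr (- a / 2))"
  have k: "k > 0" by (simp add: k_def)
  \<comment> \<open>The factor \<open>7 / 8 = 1 - (1/2)^3\<close> is the share of the ball of radius
    \<open>R\<close> taken by that shell.\<close>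
  define c where "c = k * cutoff_top\<^sup>2 * ?V * (7 / 8)"
  have c: "c > 0" using k cutoff_top_pos unit_ball_vol_3_pos by (simp add: c_def)
  \<comment> \<open>The power of \<open>sqrt 2\<close> comes from the support radius
    \<open>sqrt 2 * R\<close>; the absolute value is taken because the sign of \<open>C\<close> is
    unknown.\<close>
  define d where "d = \<bar>C\<bar> * sqrt (?V * sqrt 2 ^ 3) * sqrt K"
  have main: "c * R powr (2 - a - b) \<le> d" if R: "R \<ge> 1" for R
  proof -
    let ?F = "cutoff_wave 0 R"
    have M2: "(sqrt 2 * R)\<^sup>2 = 2 * R\<^sup>2" by (simp add: power_mult_distrib)
    have Fz: "?F s = 0" if "s > 2 * R\<^sup>2" for s using cutoff_wave_zero[of R s 0] that R by simp
    have Fb: "0 \<le> ?F s" "?F s \<le> 1" for s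
      by (simp_all add: cutoff_wave_def sinc_sqrt_0 cutoff_nonneg cutoff_le_1)
    have Fc: "continuous_on S ?F" for S by (rule smooth_continuous[OF smooth_cutoff_wave])
    have lower: "(k * R powr (- a) * cutoff_top\<^sup>2) * ?V * (R ^ 3 - (R / 2) ^ 3)
        \<le> radial_integral (\<lambda>s. (1 + s) powr (- a / 2) * (?F s * ?F s))"
    proof (rule radial_integral_ge)
      show "continuous_on {0..} (\<lambda>s. (1 + s) powr (- a / 2) * (?F s * ?F s))"
        by (intro continuous_intros Fc) auto
      show "(1 + s) powr (- a / 2) * (?F s * ?F s) = 0" if "s > 2 * R\<^sup>2" for s by (simp add: Fz that)
      fix s assume s: "(R / 2)\<^sup>2 \<le> s" "s \<le> R\<^sup>2"
      define q where "q = (1 + s) / R\<^sup>2"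
      have R2: "R\<^sup>2 \<ge> 1" using R by simp
      have "R\<^sup>2 / 4 \<le> s" using s(1) by (simp add: power_divide)
      then have "1 / 4 * R\<^sup>2 \<le> 1 + s" "1 + s \<le> 2 * R\<^sup>2"
        using s(2) R2 by linarith+
      then have q: "1 / 4 \<le> q" "q \<le> 2"
        using R by (auto simp: q_def pos_le_divide_eq pos_divide_le_eq)
      have "k \<le> q powr (- a / 2)"
      proof (cases "a \<le> 0")
        case True
        then have "(1 / 4) powr (- a / 2) \<le> q powr (- a / 2)" using q by (intro powr_mono2) auto
        then show ?thesis by (simp add: k_def)
      next
        case False
        then have "2 powr (- a / 2) \<le> q powr (- a / 2)" using q by (intro powr_mono2') auto
        then show ?thesis by (simp add: k_def)
      qed
      moreover have "(1 + s) powr (- a / 2) = q powr (- a / 2) * R powr (- a)"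
      proof -
        have "1 + s = q * R powr 2" using R by (simp add: q_def powr_numeral)
        then have "(1 + s) powr (- a / 2) = (q * R powr 2) powr (- a / 2)" by simp
        also have "\<dots> = q powr (- a / 2) * R powr (- a)" using q by (simp add: powr_mult powr_powr)
        finally show ?thesis .
      qed
      ultimately have "k * R powr (- a) \<le> (1 + s) powr (- a / 2)" by (simp add: mult_right_mono)
      then show "k * R powr (- a) * cutoff_top\<^sup>2 \<le> (1 + s) powr (- a / 2) * (?F s * ?F s)"
        using cutoff_wave_top[of R s 0] s R
        by (simp add: sinc_sqrt_0 power2_eq_square mult_right_mono)
    qed (use R k in \<open>auto simp: Fb\<close>)
    have G: "radial_integral (\<lambda>s. (?F s)\<^sup>2) \<le> 1 * ?V * (sqrt 2 * R) ^ 3"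
    proof (rule radial_integral_le)
      show "continuous_on {0..} (\<lambda>s. (?F s)\<^sup>2)" by (intro continuous_intros Fc)
      show "(?F s)\<^sup>2 = 0" if "s > (sqrt 2 * R)\<^sup>2" for s using Fz that unfolding M2 by simp
      show "(?F s)\<^sup>2 \<le> 1" for s using Fb[of s] by (simp add: power_le_one)
    qed (use R in simp)
    have "c * R powr (3 - a) = (k * R powr (- a) * cutoff_top\<^sup>2) * ?V * (R ^ 3 - (R / 2) ^ 3)"
    proof -
      have "R powr (3 - a) = R ^ 3 * R powr (- a)"
        using R by (simp add: powr_diff powr_minus powr_numeral divide_inverse)
      then show ?thesis by (simp add: c_def power_divide field_simps)
    qed
    also have "\<dots> \<le> \<bar>radial_integral (\<lambda>s. (1 + s) powr (- a / 2) * (?F s * ?F s))\<bar>"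
      using lower by linarith
    also have "\<dots> \<le> C * sqrt (radial_integral (\<lambda>s. (?F s)\<^sup>2))
        * sqrt (radial_integral (\<lambda>s. (1 + s) powr b * (radial_helmholtz 0 ?F s)\<^sup>2))"
      by (rule bilinear_bound_radial[OF assms, where M = "2 * R\<^sup>2"])
        (simp_all add: smooth_cutoff_wave Fz)
    also have "\<dots> \<le> \<bar>C\<bar> * sqrt (1 * ?V * (sqrt 2 * R) ^ 3) * sqrt (K * R powr (2 * b - 1))"
      by (intro mult_mono real_sqrt_le_mono G K)
        (use R in \<open>auto intro!: mult_nonneg_nonneg radial_integral_nonneg less_imp_le[OF unit_ball_vol_3_pos]\<close>)
    also have "\<dots> = d * (R powr (3 / 2) * R powr (b - 1 / 2))"
    proof -
      have "R ^ 3 = R powr 3" using R by (simp add: powr_numeral)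
      then have "sqrt (R ^ 3) = R powr (3 / 2)" by (simp add: powr_half_sqrt[symmetric] powr_powr)
      moreover have "sqrt (R powr (2 * b - 1)) = R powr (b - 1 / 2)"
        by (simp add: powr_half_sqrt[symmetric] powr_powr diff_divide_distrib)
      ultimately show ?thesis by (simp add: d_def power_mult_distrib real_sqrt_mult mult_ac)
    qed
    also have "\<dots> = d * R powr (1 + b)" by (simp add: powr_add[symmetric])
    finally have "c * R powr (3 - a) \<le> d * R powr (1 + b)" .
    moreover have "R powr (3 - a) = R powr (2 - a - b) * R powr (1 + b)"
      by (simp add: powr_add[symmetric])
    ultimately have "(c * R powr (2 - a - b)) * R powr (1 + b) \<le> d * R powr (1 + b)"
      by (simp add: mult_ac)
    then show ?thesis using R by (simp add: mult_le_cancel_right)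
  qed
  \<comment> \<open>\<open>L\<close> exceeds \<open>d / c\<close>, and \<open>R\<close> is chosen so
    that \<open>R powr (2 - a - b) = L\<close>; the maximum with \<open>1\<close> ensures
    \<open>R \<ge> 1\<close>.\<close>
  define L where "L = max 1 (d / c + 1)"
  define R where "R = L powr (1 / (2 - a - b))"
  have "L \<ge> 1" by (simp add: L_def)
  then have "R \<ge> 1" using ab by (simp add: R_def ge_one_powr_ge_zero)
  moreover have "R powr (2 - a - b) = L" using ab \<open>L \<ge> 1\<close> by (simp add: R_def powr_powr)
  ultimately have "c * L \<le> d" using main[of R] by simp
  then have "L \<le> d / c" using c by (simp add: pos_le_divide_eq mult.commute)
  then show False by (simp add: L_def)
qed

section \<open>Dyadic averages of spherical waves and the threshold \<open>1 / 2\<close>\<close>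

text \<open>Averaging the cutoff over \<open>N\<close> dyadic scales plays the role of a logarithmic cutoff; it gains a
  factor \<open>1 / N\<close> in the energy and so reaches the endpoint \<open>b = 1 / 2\<close>.\<close>

definition mean_wave :: "real \<Rightarrow> nat \<Rightarrow> real \<Rightarrow> real" where
  "mean_wave \<kappa> N s = (1 / real N) * (\<Sum>j<N. cutoff_wave \<kappa> (2 ^ j) s)"

lemma smooth_mean_wave: "smooth (mean_wave \<kappa> N)"
  unfolding mean_wave_def[abs_def] by (intro smooth_mult smooth_const smooth_sum smooth_cutoff_wave)

lemma radial_helmholtz_mean_wave:
  "radial_helmholtz \<kappa> (mean_wave \<kappa> N) s = (1 / real N) * (\<Sum>j<N. radial_helmholtz \<kappa> (cutoff_wave \<kappa> (2 ^ j)) s)"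
proof -
  have 1: "deriv (\<lambda>s. c * (\<Sum>j<N. f j s)) = (\<lambda>s. c * (\<Sum>j<N. deriv (f j) s))"
    if "\<And>j. smooth (f j)" for f and c :: real
    by (intro ext DERIV_imp_deriv DERIV_cmult DERIV_sum smooth_deriv(1) that)
  have "deriv (mean_wave \<kappa> N) = (\<lambda>s. (1 / real N) * (\<Sum>j<N. deriv (cutoff_wave \<kappa> (2 ^ j)) s))"
    unfolding mean_wave_def[abs_def] by (rule 1) (rule smooth_cutoff_wave)
  moreover have "deriv (\<lambda>s. (1 / real N) * (\<Sum>j<N. deriv (cutoff_wave \<kappa> (2 ^ j)) s))
      = (\<lambda>s. (1 / real N) * (\<Sum>j<N. deriv (deriv (cutoff_wave \<kappa> (2 ^ j))) s))"
    by (rule 1) (rule smooth_deriv(2)[OF smooth_cutoff_wave])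
  ultimately show ?thesis
    by (simp add: radial_helmholtz_def mean_wave_def sum.distrib sum_distrib_left sum_distrib_right algebra_simps)
qed

lemma mean_wave_zero:
  assumes "s > 2 * (2 ^ N)\<^sup>2" shows "mean_wave \<kappa> N s = 0"
proof -
  have "cutoff_wave \<kappa> (2 ^ j) s = 0" if "j < N" for j
  proof (rule cutoff_wave_zero)
    have "(2 ^ j :: real) \<le> 2 ^ N" using that by simp
    then have "(2 ^ j :: real)\<^sup>2 \<le> (2 ^ N)\<^sup>2" by (intro power_mono) auto
    then show "s \<ge> 2 * (2 ^ j)\<^sup>2" using assms by linarith
  qed simp
  then show ?thesis by (simp add: mean_wave_def)
qed

text \<open>All scales \<open>2 ^ j\<close> are at least \<open>1\<close>, so on the unit ball every
  cutoff in the average is still on its plateau.\<close>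

lemma mean_wave_top:
  assumes "N > 0" "s \<le> 1" shows "mean_wave \<kappa> N s = cutoff_top * sinc_sqrt (\<kappa> * s)"
proof -
  have "s \<le> (2 ^ j)\<^sup>2" for j :: nat using assms(2) order_trans[of s 1 "(2 ^ j)\<^sup>2"] by simp
  then have "cutoff_wave \<kappa> (2 ^ j) s = cutoff_top * sinc_sqrt (\<kappa> * s)" for j
    by (intro cutoff_wave_top) auto
  then show ?thesis using assms by (simp add: mean_wave_def)
qed

text \<open>The Helmholtz terms of different scales live on disjoint shells, so the square of their
  sum is the sum of their squares. Each of the \<open>N\<close> energies is at most
  \<open>K\<close>, since \<open>2 * b - 1 \<le> 0\<close>, and the averaging factor
  \<open>1 / N^2\<close> leaves \<open>K / N\<close>.\<close>

lemma mean_wave_energy: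
  assumes "b \<le> 1 / 2"
  obtains K where "K \<ge> 0"
    "\<And>\<kappa> N. \<kappa> \<ge> 0 \<Longrightarrow> N > 0 \<Longrightarrow>
       radial_integral (\<lambda>s. (1 + s) powr b * (radial_helmholtz \<kappa> (mean_wave \<kappa> N) s)\<^sup>2) \<le> K / real N"
proof -
  obtain K where K: "K \<ge> 0" "\<And>\<kappa> R. R \<ge> 1 \<Longrightarrow> \<kappa> \<ge> 0 \<Longrightarrow>
       radial_integral (\<lambda>s. (1 + s) powr b * (radial_helmholtz \<kappa> (cutoff_wave \<kappa> R) s)\<^sup>2) \<le> K * R powr (2 * b - 1)"
    by (rule cutoff_wave_energy[of b]) blast
  obtain K0 where zero: "K0 \<ge> 0" "\<And>\<kappa> R s. R > 0 \<Longrightarrow> \<kappa> \<ge> 0 \<Longrightarrow> s \<ge> 0 \<Longrightarrow> \<bar>radial_helmholtz \<kappa> (cutoff_wave \<kappa> R) s\<bar> \<le> K0 / R\<^sup>2"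
    "\<And>\<kappa> R s. R > 0 \<Longrightarrow> s \<notin> {R\<^sup>2..2 * R\<^sup>2} \<Longrightarrow> radial_helmholtz \<kappa> (cutoff_wave \<kappa> R) s = 0"
    by (rule radial_helmholtz_cutoff_wave_bound) blast
  show ?thesis
  proof (rule that[OF K(1)])
    fix \<kappa> :: real and N :: nat assume \<kappa>: "\<kappa> \<ge> 0" and N: "N > 0"
    define D where "D j s = radial_helmholtz \<kappa> (cutoff_wave \<kappa> (2 ^ j)) s" for j :: nat and s
    \<comment> \<open>The shells for \<open>s\<close> are \<open>[4^j, 2 * 4^j]\<close>, and
      \<open>4^(i+1)\<close> exceeds \<open>2 * 4^i\<close>.\<close>
    have disjoint: "D i s * D j s = 0" if "i < j" for i j s
    proof (rule ccontr)
      assume "D i s * D j s \<noteq> 0"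
      then have "s \<in> {(2 ^ i)\<^sup>2..2 * (2 ^ i)\<^sup>2}" "s \<in> {(2 ^ j)\<^sup>2..2 * (2 ^ j)\<^sup>2}"
        using zero(3)[of "2 ^ i" s \<kappa>] zero(3)[of "2 ^ j" s \<kappa>] unfolding D_def by force+
      moreover have "(2 ^ Suc i :: real)\<^sup>2 \<le> (2 ^ j)\<^sup>2"
        using that by (intro power_mono power_increasing) auto
      moreover have "(2 ^ Suc i :: real)\<^sup>2 = 4 * (2 ^ i)\<^sup>2" by (simp add: power_mult_distrib)
      moreover have "(2 ^ i :: real)\<^sup>2 > 0" by simp
      ultimately show False unfolding atLeastAtMost_iff by linarith
    qed
    have disjoint': "D i s * D j s = 0" if "i \<noteq> j" for i j s
      using disjoint[of i j s] disjoint[of j i s] that by (cases i j rule: linorder_cases) (auto simp: mult.commute)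
    have square: "(\<Sum>j<N. D j s)\<^sup>2 = (\<Sum>j<N. (D j s)\<^sup>2)" for s
    proof -
      have "(\<Sum>j<N. D j s)\<^sup>2 = (\<Sum>i<N. \<Sum>j<N. D i s * D j s)"
        by (simp add: power2_eq_square sum_product)
      also have "\<dots> = (\<Sum>i<N. \<Sum>j<N. if j = i then (D i s)\<^sup>2 else 0)"
        using disjoint' by (intro sum.cong refl) (auto simp: power2_eq_square)
      also have "\<dots> = (\<Sum>j<N. (D j s)\<^sup>2)" by (simp add: sum.delta)
      finally show ?thesis .
    qed
    have int: "integrable lborel (\<lambda>x :: real ^ 3. (1 + x \<bullet> x) powr b * (D j (x \<bullet> x))\<^sup>2)" for j
    proof (rule radial_integrable)
      show "continuous_on {0..} (\<lambda>s. (1 + s) powr b * (D j s)\<^sup>2)"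
        unfolding D_def by (intro continuous_intros radial_helmholtz_continuous smooth_cutoff_wave) auto
      show "(1 + s) powr b * (D j s)\<^sup>2 = 0" if "s > 2 * (2 ^ j)\<^sup>2" for s
        using zero(3)[of "2 ^ j" s \<kappa>] that by (simp add: D_def)
    qed
    have "radial_integral (\<lambda>s. (1 + s) powr b * (radial_helmholtz \<kappa> (mean_wave \<kappa> N) s)\<^sup>2)
        = radial_integral (\<lambda>s. (1 / (real N)\<^sup>2) * (\<Sum>j<N. (1 + s) powr b * (D j s)\<^sup>2))"
      unfolding radial_helmholtz_mean_wave D_def[symmetric] power_mult_distrib square
      by (simp add: power_divide sum_distrib_left mult_ac)
    also have "\<dots> = (1 / (real N)\<^sup>2) * (\<Sum>j<N. radial_integral (\<lambda>s. (1 + s) powr b * (D j s)\<^sup>2))"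
      unfolding radial_integral_def by (simp add: int)
    also have "\<dots> \<le> (1 / (real N)\<^sup>2) * (\<Sum>j<N. K)"
    proof (intro mult_left_mono sum_mono)
      fix j :: nat
      have "radial_integral (\<lambda>s. (1 + s) powr b * (D j s)\<^sup>2) \<le> K * (2 ^ j) powr (2 * b - 1)"
        unfolding D_def using K(2)[of "2 ^ j" \<kappa>] \<kappa> by simp
      also have "\<dots> \<le> K * 1"
      proof (rule mult_left_mono[OF _ K(1)])
        have "(2 ^ j :: real) powr (2 * b - 1) \<le> (2 ^ j) powr 0"
          using assms by (intro powr_mono) auto
        then show "(2 ^ j :: real) powr (2 * b - 1) \<le> 1" by simp
      qed
      finally show "radial_integral (\<lambda>s. (1 + s) powr b * (D j s)\<^sup>2) \<le> K" by simp
    qed simp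
    also have "\<dots> = K / real N" using N by (simp add: power2_eq_square)
    finally show "radial_integral (\<lambda>s. (1 + s) powr b * (radial_helmholtz \<kappa> (mean_wave \<kappa> N) s)\<^sup>2) \<le> K / real N" .
  qed
qed

text \<open>A fixed bump \<open>G\<close> near the origin pairs with every mean wave to at least a
  constant \<open>c > 0\<close>, whereas the energy of the mean wave tends to \<open>0\<close> as
  \<open>N\<close> grows.\<close>

lemma bilinear_bound_slow_decay:
  assumes "bilinear_bound a b C" shows "b > 1 / 2"
proof (rule ccontr)
  assume "\<not> b > 1 / 2"
  then have b: "b \<le> 1 / 2" by simp
  \<comment> \<open>One sample positive energy below \<open>1\<close>.\<close>
  define \<kappa> :: real where "\<kappa> = 1 / 4"
  obtain K where K: "K \<ge> 0" "\<And>\<kappa> N. \<kappa> \<ge> 0 \<Longrightarrow> N > 0 \<Longrightarrow>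
       radial_integral (\<lambda>s. (1 + s) powr b * (radial_helmholtz \<kappa> (mean_wave \<kappa> N) s)\<^sup>2) \<le> K / real N"
    using mean_wave_energy[OF b] by metis
  have "isCont sinc_sqrt 0"
    using smooth_continuous[OF smooth_sinc_sqrt, of UNIV] by (simp add: continuous_on_eq_continuous_at)
  then have "\<forall>\<^sub>F s in nhds 0. sinc_sqrt s > 1 / 2"
    using order_tendstoD(1)[of sinc_sqrt "sinc_sqrt 0" "nhds 0" "1 / 2"]
    by (simp add: continuous_at tendsto_nhds_iff sinc_sqrt_0)
  then obtain \<delta>' where \<delta>': "\<delta>' > 0" "\<And>s. \<bar>s\<bar> < \<delta>' \<Longrightarrow> sinc_sqrt s > 1 / 2"
    by (auto simp: eventually_nhds_metric dist_real_def)
  \<comment> \<open>For \<open>s \<le> \<delta>\<close> the wave factor is at least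
    \<open>1 / 2\<close>; the cap \<open>1\<close> places the support of \<open>G\<close> inside the
    common plateau of the mean waves.\<close>
  define \<delta> where "\<delta> = min 1 \<delta>'"
  have \<delta>: "\<delta> > 0" "\<delta> \<le> 1" using \<delta>' by (auto simp: \<delta>_def)
  have sinc: "sinc_sqrt (\<kappa> * s) \<ge> 1 / 2" if "0 \<le> s" "s \<le> \<delta>" for s
    using \<delta>'(2)[of "\<kappa> * s"] that \<delta> by (auto simp: \<kappa>_def \<delta>_def)
  define G where "G s = cutoff ((2 / \<delta>) * s)" for s
  have G: "smooth G" "\<And>s. G s \<ge> 0" unfolding G_def[abs_def]
    by (rule smooth_dilation[OF smooth_cutoff]) (rule cutoff_nonneg)
  have Gz: "G s = 0" if "s \<ge> \<delta>" for s
    using that \<delta> by (auto simp: G_def field_simps intro!: cutoff_eq_0)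
  have Gt: "G s = cutoff_top" if "s \<le> \<delta> / 2" for s
    using that \<delta> by (auto simp: G_def field_simps intro!: cutoff_eq_top)
  define k where "k = min 1 (2 powr (- a / 2))"
  have k: "k > 0" by (simp add: k_def)
  have weight: "(1 + s) powr (- a / 2) \<ge> k" if s: "0 \<le> s" "s \<le> 1" for s
  proof (cases "a \<le> 0")
    case True
    then have "1 powr (- a / 2) \<le> (1 + s) powr (- a / 2)" using s by (intro powr_mono2) auto
    then show ?thesis by (simp add: k_def)
  next
    case False
    then have "2 powr (- a / 2) \<le> (1 + s) powr (- a / 2)" using s by (intro powr_mono2') auto
    then show ?thesis by (simp add: k_def)
  qed
  \<comment> \<open>The integrand is bounded below on the ball
    \<open>|x|^2 \<le> \<delta> / 2\<close>, where \<open>G\<close> is on its plateau; the term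
    \<open>0 ^ 3\<close> is the inner radius of a degenerate shell.\<close>
  define c where "c = (k * (cutoff_top * (cutoff_top * (1 / 2)))) * unit_ball_vol 3 * (sqrt (\<delta> / 2) ^ 3 - 0 ^ 3)"
  have c: "c > 0" using k \<delta> cutoff_top_pos unit_ball_vol_3_pos by (simp add: c_def)
  have lower: "c \<le> radial_integral (\<lambda>s. (1 + s) powr (- a / 2) * (G s * mean_wave \<kappa> N s))" if N: "N > 0" for N
    unfolding c_def
  proof (rule radial_integral_ge)
    show "continuous_on {0..} (\<lambda>s. (1 + s) powr (- a / 2) * (G s * mean_wave \<kappa> N s))"
      by (intro continuous_intros smooth_continuous[OF G(1)] smooth_continuous[OF smooth_mean_wave]) auto
    show "(1 + s) powr (- a / 2) * (G s * mean_wave \<kappa> N s) = 0" if "s > \<delta>" for s using Gz that by simp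
    have mw: "mean_wave \<kappa> N s \<ge> cutoff_top * (1 / 2)" if "0 \<le> s" "s \<le> \<delta>" for s
    proof -
      have "mean_wave \<kappa> N s = cutoff_top * sinc_sqrt (\<kappa> * s)" using that \<delta> by (intro mean_wave_top[OF N]) simp
      then show ?thesis using sinc[OF that] cutoff_top_pos by (simp add: mult_left_mono del: times_divide_eq_right)
    qed
    show "(1 + s) powr (- a / 2) * (G s * mean_wave \<kappa> N s) \<ge> 0" if "s \<ge> 0" for s
    proof (cases "s \<le> \<delta>")
      case True
      have "0 \<le> cutoff_top * (1 / 2)" using cutoff_top_pos by simp
      then have "mean_wave \<kappa> N s \<ge> 0" using mw[OF that True] by linarith
      then show ?thesis using G(2)[of s] by simp
    next
      case False
      then show ?thesis using Gz by simp
    qed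
    fix s :: real assume s: "0\<^sup>2 \<le> s" "s \<le> (sqrt (\<delta> / 2))\<^sup>2"
    then have s': "0 \<le> s" "s \<le> \<delta> / 2" "s \<le> \<delta>" "s \<le> 1" using \<delta> by auto
    show "k * (cutoff_top * (cutoff_top * (1 / 2))) \<le> (1 + s) powr (- a / 2) * (G s * mean_wave \<kappa> N s)"
      unfolding Gt[OF s'(2)] using s' k cutoff_top_pos
      by (intro mult_mono weight mw order_refl) auto
  qed (use \<delta> k cutoff_top_pos in auto)
  let ?g = "sqrt (radial_integral (\<lambda>s. (G s)\<^sup>2))"
  \<comment> \<open>Indexing by \<open>Suc n\<close> keeps the number of averaged scales
    positive.\<close>
  have "c \<le> \<bar>C\<bar> * ?g * sqrt (K * (1 / real (Suc n)))" for n
  proof -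
    let ?N = "Suc n"
    let ?E = "radial_integral (\<lambda>s. (1 + s) powr b * (radial_helmholtz \<kappa> (mean_wave \<kappa> ?N) s)\<^sup>2)"
    have "c \<le> \<bar>radial_integral (\<lambda>s. (1 + s) powr (- a / 2) * (G s * mean_wave \<kappa> ?N s))\<bar>"
      using lower[of ?N] by linarith
    also have "\<dots> \<le> C * ?g * sqrt ?E"
    proof (rule bilinear_bound_radial[OF assms, where M = "2 * (2 ^ ?N)\<^sup>2"])
      show "G s = 0" if "s > 2 * (2 ^ ?N)\<^sup>2" for s
      proof (rule Gz)
        have "(1 :: real) \<le> (2 ^ ?N)\<^sup>2" by (intro one_le_power) simp
        then show "\<delta> \<le> s" using that \<delta> by linarith
      qed
    qed (simp_all add: \<kappa>_def smooth_mean_wave mean_wave_zero G del: power_Suc)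
    also have "\<dots> \<le> \<bar>C\<bar> * ?g * sqrt (K * (1 / real ?N))"
      using K(2)[of \<kappa> ?N]
      by (intro mult_mono real_sqrt_le_mono)
        (auto simp: \<kappa>_def intro!: radial_integral_nonneg mult_nonneg_nonneg)
    finally show ?thesis .
  qed
  moreover have "(\<lambda>n. \<bar>C\<bar> * ?g * sqrt (K * (1 / real (Suc n)))) \<longlonglongrightarrow> \<bar>C\<bar> * ?g * sqrt (K * 0)"
    by (intro tendsto_intros LIMSEQ_Suc[OF lim_1_over_n])
  ultimately have "c \<le> \<bar>C\<bar> * ?g * sqrt (K * 0)" by (intro LIMSEQ_le_const) auto
  then show False using c by simp
qed

theorem mainTheorem2:
  fixes \<alpha> \<beta> :: real
  assumes "\<alpha> \<le> 1 / 2 \<or> \<beta> \<le> 1 / 2 \<or> \<alpha> + \<beta> < 2"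
  shows "\<not> (\<exists>C::real. \<forall>z::complex. z \<notin> \<real> \<and> cmod z < 1 \<longrightarrow>
           bounded_with_norm_le (weighted_resolvent \<alpha> \<beta> z) C)"
proof
  assume "\<exists>C::real. \<forall>z::complex. z \<notin> \<real> \<and> cmod z < 1 \<longrightarrow>
           bounded_with_norm_le (weighted_resolvent \<alpha> \<beta> z) C"
  then obtain C where C: "\<And>z. z \<notin> \<real> \<Longrightarrow> cmod z < 1 \<Longrightarrow>
      bounded_with_norm_le (weighted_resolvent \<alpha> \<beta> z) C" by blast
  \<comment> \<open>The direct and the dual estimate give the same bound with the exponents
    exchanged, so the threshold \<open>1 / 2\<close> applies to \<beta> through the first and to
    \<alpha> through the second.\<close>
  have "bilinear_bound \<alpha> \<beta> C" "bilinear_bound \<beta> \<alpha> C"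
    unfolding bilinear_bound_def
    using weighted_resolvent_bound_direct[OF C] weighted_resolvent_bound_dual[OF C] by blast+
  then have "\<beta> > 1 / 2" "\<alpha> > 1 / 2" "\<alpha> + \<beta> \<ge> 2"
    using bilinear_bound_slow_decay bilinear_bound_scaling by blast+
  then show False using assms by linarith
qed

end
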